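(* Fix $\beta>0$ and $h\in\mathbb{R}$, and suppose there is a number $q<1$ and a constant $C_0$ depending only on $\beta,h$ such that for every $N$, $$\mathbb{E}\langle (R_{12}-q)^4\rangle \le \frac{C_0}{N^2}.$$ Let $g_1,\dots,g_N$ be i.i.d. standard Gaussian random variables independent of the disorder $(g_{ij})$, and define the cavity field $\ell := \frac{1}{\sqrt N}\sum_{i=1}^N g_i\sigma_i$, so that $\langle\ell\rangle = \frac{1}{\sqrt N}\sum_{i=1}^N g_i\langle\sigma_i\rangle$. Then there is a constant $C(\beta,h)$ depending only on $\beta,h$ (and the constants in the hypothesis) such that for every $N$ and every bounded measurable $u:\mathbb{R}\to\mathbb{R}$, $$\mathbb{E}\Bigl(\langle u(\ell)\rangle - \int_{\mathbb{R}} u(t)\,\phi_{\langle\ell\rangle,1-q}(t)\,dt\Bigr)^2 \le \frac{C(\beta,h)\|u\|_\infty^2}{\sqrt N},$$ where $\mathbb{E}$ is the expectation over both $(g_{ij})$ and $(g_i)$.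
   Context: Sherrington–Kirkpatrick model: for a positive integer $N$, let $\Sigma_N=\{-1,1\}^N$ and let $(g_{ij})_{1\le i<j\le N}$ be i.i.d. standard Gaussian random variables (the disorder). Given the disorder, the Gibbs measure on $\Sigma_N$ is $G_N(\sigma)=Z_N^{-1}\exp\bigl(\frac{\beta}{\sqrt N}\sum_{1\le i<j\le N} g_{ij}\sigma_i\sigma_j + h\sum_{i=1}^N\sigma_i\bigr)$, with $Z_N$ the normalizing constant. Replicas $\sigma^1,\sigma^2,\dots$ are independent samples from $G_N$ given the disorder, and $\langle\cdot\rangle$ denotes the corresponding quenched average (expectation over replicas with all Gaussian variables fixed). The overlap is $R_{12}=\frac1N\sum_{i=1}^N\sigma^1_i\sigma^2_i$. $\phi_{\mu,s^2}(x)=\frac{1}{\sqrt{2\pi}s}e^{-(x-\mu)^2/(2s^2)}$ is the Gaussian density with mean $\mu$ and variance $s^2$. *)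

theory Defs
  imports "HOL-Probability.Probability"
begin

definition spins :: "nat \<Rightarrow> (nat \<Rightarrow> real) set" where
  "spins N = {\<sigma>. (\<forall>i<N. \<sigma> i = 1 \<or> \<sigma> i = -1) \<and> (\<forall>i\<ge>N. \<sigma> i = 0)}"

definition pairs :: "nat \<Rightarrow> (nat \<times> nat) set" where
  "pairs N = {(i, j). i < j \<and> j < N}"

definition gauss :: "'i set \<Rightarrow> ('i \<Rightarrow> real) measure" where
  "gauss I = (\<Pi>\<^sub>M i\<in>I. density lborel std_normal_density)"

definition SK_H :: "real \<Rightarrow> real \<Rightarrow> nat \<Rightarrow> (nat \<times> nat \<Rightarrow> real) \<Rightarrow> (nat \<Rightarrow> real) \<Rightarrow> real" where
  "SK_H \<beta> h N g \<sigma> =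
     \<beta> / sqrt (real N) * (\<Sum>(i, j)\<in>pairs N. g (i, j) * \<sigma> i * \<sigma> j) + h * (\<Sum>i<N. \<sigma> i)"

definition SK_Z :: "real \<Rightarrow> real \<Rightarrow> nat \<Rightarrow> (nat \<times> nat \<Rightarrow> real) \<Rightarrow> real" where
  "SK_Z \<beta> h N g = (\<Sum>\<sigma>\<in>spins N. exp (SK_H \<beta> h N g \<sigma>))"

definition gibbs :: "real \<Rightarrow> real \<Rightarrow> nat \<Rightarrow> (nat \<times> nat \<Rightarrow> real) \<Rightarrow> (nat \<Rightarrow> real) \<Rightarrow> real" where
  "gibbs \<beta> h N g \<sigma> = exp (SK_H \<beta> h N g \<sigma>) / SK_Z \<beta> h N g"

definition gavg1 :: "real \<Rightarrow> real \<Rightarrow> nat \<Rightarrow> (nat \<times> nat \<Rightarrow> real) \<Rightarrow> ((nat \<Rightarrow> real) \<Rightarrow> real) \<Rightarrow> real" where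
  "gavg1 \<beta> h N g f = (\<Sum>\<sigma>\<in>spins N. f \<sigma> * gibbs \<beta> h N g \<sigma>)"

definition gavg2 :: "real \<Rightarrow> real \<Rightarrow> nat \<Rightarrow> (nat \<times> nat \<Rightarrow> real)
     \<Rightarrow> ((nat \<Rightarrow> real) \<Rightarrow> (nat \<Rightarrow> real) \<Rightarrow> real) \<Rightarrow> real" where
  "gavg2 \<beta> h N g f =
     (\<Sum>\<sigma>1\<in>spins N. \<Sum>\<sigma>2\<in>spins N. f \<sigma>1 \<sigma>2 * gibbs \<beta> h N g \<sigma>1 * gibbs \<beta> h N g \<sigma>2)"

definition overlap :: "nat \<Rightarrow> (nat \<Rightarrow> real) \<Rightarrow> (nat \<Rightarrow> real) \<Rightarrow> real" where
  "overlap N \<sigma>1 \<sigma>2 = (\<Sum>i<N. \<sigma>1 i * \<sigma>2 i) / real N"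

definition cavity :: "nat \<Rightarrow> (nat \<Rightarrow> real) \<Rightarrow> (nat \<Rightarrow> real) \<Rightarrow> real" where
  "cavity N z \<sigma> = (\<Sum>i<N. z i * \<sigma> i) / sqrt (real N)"

end

theory Submission
  imports Defs
begin

text \<open>
  Fix the disorder. Expanding the square gives three Gaussian expectations \<open>E u(X) u(Y)\<close>, with
  \<open>(X, Y)\<close> equal to \<open>(\<ell>\<^sup>1, \<ell>\<^sup>2)\<close>, to \<open>(\<ell>\<^sup>1, m + \<tau>\<xi>)\<close> and to \<open>(m + \<tau>\<xi>, m + \<tau>\<xi>')\<close>, where \<open>m = \<langle>\<ell>\<rangle>\<close>,
  \<open>\<tau>\<^sup>2 = 1 - q\<close> and \<open>\<xi>, \<xi>'\<close> are fresh standard normals. All three pairs are centred Gaussian with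
  covariance matrix within \<open>O(\<bar>R - q\<bar>)\<close> of the one with unit variances and covariance \<open>q\<close>, which is
  nondegenerate since \<open>0 \<le> q < 1\<close>. Hence each expectation is within
  \<open>O(\<parallel>u\<parallel>\<^sup>2 \<langle>\<bar>R\<^sub>1\<^sub>2 - q\<bar>\<rangle>)\<close> of a common value, which cancels because the coefficients
  \<open>1, -2, 1\<close> sum to zero. The fourth moment hypothesis bounds \<open>E\<langle>\<bar>R\<^sub>1\<^sub>2 - q\<bar>\<rangle>\<close> by \<open>O(1/\<surd>N)\<close>.
  For \<open>q < 0\<close> the pointwise bound is trivial, as \<open>\<langle>R\<^sub>1\<^sub>2\<rangle> \<ge> 0\<close> forces \<open>\<langle>\<bar>R\<^sub>1\<^sub>2 - q\<bar>\<rangle> \<ge> -q\<close>.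
\<close>

section \<open>Rotation invariance and linear images of Gaussian vectors\<close>

abbreviation std_normal :: "real measure" where
  "std_normal \<equiv> density lborel (\<lambda>x. ennreal (std_normal_density x))"

lemma prob_space_std_normal: "prob_space std_normal"
  by (rule prob_space_normal_density) simp

interpretation std_normal: prob_space std_normal
  by (rule prob_space_std_normal)

interpretation std_normal_pair: pair_prob_space std_normal std_normal ..

text \<open>For fixed \<open>x\<close> the shear is a translation in \<open>y\<close>, so
  one-dimensional translation invariance of Lebesgue measure suffices.\<close>

lemma nn_integral_shear:
  fixes t :: real
  assumes [measurable]: "f \<in> borel_measurable (borel \<Otimes>\<^sub>M borel)"
  shows "(\<integral>\<^sup>+x. \<integral>\<^sup>+y. f (x, y + t * x) \<partial>lborel \<partial>lborel) = (\<integral>\<^sup>+x. \<integral>\<^sup>+y. f (x, y) \<partial>lborel \<partial>lborel)"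
proof (rule nn_integral_cong)
  fix x :: real
  show "(\<integral>\<^sup>+y. f (x, y + t * x) \<partial>lborel) = (\<integral>\<^sup>+y. f (x, y) \<partial>lborel)"
    using nn_integral_real_affine[of "\<lambda>y. f (x, y)" 1 "t * x"] by (simp add: add.commute)
qed

lemma nn_integral_shear':
  fixes t :: real
  assumes [measurable]: "f \<in> borel_measurable (borel \<Otimes>\<^sub>M borel)"
  shows "(\<integral>\<^sup>+x. \<integral>\<^sup>+y. f (x + t * y, y) \<partial>lborel \<partial>lborel) = (\<integral>\<^sup>+x. \<integral>\<^sup>+y. f (x, y) \<partial>lborel \<partial>lborel)"
proof -
  have "(\<integral>\<^sup>+x. \<integral>\<^sup>+y. f (x + t * y, y) \<partial>lborel \<partial>lborel) = (\<integral>\<^sup>+y. \<integral>\<^sup>+x. f (x + t * y, y) \<partial>lborel \<partial>lborel)"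
    by (rule lborel_pair.Fubini'[symmetric]) measurable
  also have "\<dots> = (\<integral>\<^sup>+y. \<integral>\<^sup>+x. f (x, y) \<partial>lborel \<partial>lborel)"
    using nn_integral_shear[of "\<lambda>(y, x). f (x, y)" t] by simp
  also have "\<dots> = (\<integral>\<^sup>+x. \<integral>\<^sup>+y. f (x, y) \<partial>lborel \<partial>lborel)"
    by (rule lborel_pair.Fubini') measurable
  finally show ?thesis .
qed

text \<open>A rotation by an angle other than \<open>\<pi>\<close> is a product of three shears.\<close>

lemma nn_integral_lborel_rotation:
  assumes [measurable]: "f \<in> borel_measurable (borel \<Otimes>\<^sub>M borel)"
    and cs: "c\<^sup>2 + s\<^sup>2 = (1::real)" and c: "c \<noteq> -1"
  shows "(\<integral>\<^sup>+x. \<integral>\<^sup>+y. f (c * x - s * y, s * x + c * y) \<partial>lborel \<partial>lborel)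
    = (\<integral>\<^sup>+x. \<integral>\<^sup>+y. f (x, y) \<partial>lborel \<partial>lborel)"
proof -
  \<comment> \<open>The shears have parameters \<open>t\<close>, \<open>s\<close>, \<open>t\<close>,
    where \<open>t\<close> is minus the tangent of half the angle; composing them gives the rotation
    once \<open>t * (1 + c) = - s\<close> and \<open>1 + t * s = c\<close>.\<close>
  define t where "t = - s / (1 + c)"
  have t: "t * (1 + c) = - s" using c by (simp add: t_def add_eq_0_iff)
  have st: "1 + t * s = c"
  proof -
    have "(1 + c) * (1 + t * s) = (1 + c) + (t * (1 + c)) * s" by (simp add: algebra_simps)
    also have "\<dots> = (1 + c) * c" unfolding t using cs by (simp add: algebra_simps power2_eq_square)
    finally show ?thesis using c by (simp add: add_eq_0_iff)
  qed
  have eq: "y + s * (x + t * y) = s * x + c * y"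
    "(x + t * y) + t * (s * x + c * y) = c * x - s * y" for x y
  proof -
    show *: "y + s * (x + t * y) = s * x + c * y"
      using st by (simp add: algebra_simps flip: st)
    show "(x + t * y) + t * (s * x + c * y) = c * x - s * y"
      proof -
      have "(x + t * y) + t * (s * x + c * y) = (1 + t * s) * x + (t * (1 + c)) * y"
        by (simp add: algebra_simps)
      then show ?thesis unfolding st t by simp
    qed
  qed
  have "(\<integral>\<^sup>+x. \<integral>\<^sup>+y. f (x, y) \<partial>lborel \<partial>lborel) = (\<integral>\<^sup>+x. \<integral>\<^sup>+y. f (x + t * y, y) \<partial>lborel \<partial>lborel)"
    by (rule nn_integral_shear'[symmetric]) measurable
  also have "\<dots> = (\<integral>\<^sup>+x. \<integral>\<^sup>+y. f (x + t * (y + s * x), y + s * x) \<partial>lborel \<partial>lborel)"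
    using nn_integral_shear[of "\<lambda>(x, y). f (x + t * y, y)" s] by simp
  also have "\<dots> = (\<integral>\<^sup>+x. \<integral>\<^sup>+y. f ((x + t * y) + t * (y + s * (x + t * y)), y + s * (x + t * y)) \<partial>lborel \<partial>lborel)"
    using nn_integral_shear'[of "\<lambda>(x, y). f (x + t * (y + s * x), y + s * x)" t] by simp
  finally show ?thesis by (simp add: eq)
qed

text \<open>The product density depends on \<open>(x, y)\<close> only through x^2 + y^2, which
  rotations preserve, so the Lebesgue case applies to density times integrand.\<close>

lemma nn_integral_std_normal_rotation:
  assumes [measurable]: "f \<in> borel_measurable (borel \<Otimes>\<^sub>M borel)"
    and cs: "c\<^sup>2 + s\<^sup>2 = (1::real)" and c: "c \<noteq> -1"
  shows "(\<integral>\<^sup>+x. \<integral>\<^sup>+y. f (c * x - s * y, s * x + c * y) \<partial>std_normal \<partial>std_normal)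
    = (\<integral>\<^sup>+x. \<integral>\<^sup>+y. f (x, y) \<partial>std_normal \<partial>std_normal)"
proof -
  define d where "d x y = ennreal (std_normal_density x * std_normal_density y)" for x y
  have d: "d x y = ennreal (exp (- (x\<^sup>2 + y\<^sup>2) / 2) / (2 * pi))" for x y
    by (simp add: d_def std_normal_density_def real_sqrt_mult[symmetric] mult_exp_exp add_divide_distrib)
  have d_rot: "d (c * x - s * y) (s * x + c * y) = d x y" for x y
  proof -
    have "(c * x - s * y)\<^sup>2 + (s * x + c * y)\<^sup>2 = (c\<^sup>2 + s\<^sup>2) * (x\<^sup>2 + y\<^sup>2)" by algebra
    then show ?thesis by (simp add: d cs)
  qed
  have *: "(\<integral>\<^sup>+x. \<integral>\<^sup>+y. g (x, y) \<partial>std_normal \<partial>std_normal) = (\<integral>\<^sup>+x. \<integral>\<^sup>+y. d x y * g (x, y) \<partial>lborel \<partial>lborel)"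
    if [measurable]: "g \<in> borel_measurable (borel \<Otimes>\<^sub>M borel)" for g
  proof -
    have "(\<integral>\<^sup>+x. \<integral>\<^sup>+y. g (x, y) \<partial>std_normal \<partial>std_normal) =
      (\<integral>\<^sup>+x. ennreal (std_normal_density x) * (\<integral>\<^sup>+y. ennreal (std_normal_density y) * g (x, y) \<partial>lborel) \<partial>lborel)"
      by (subst nn_integral_density, measurable)+
    also have "\<dots> = (\<integral>\<^sup>+x. \<integral>\<^sup>+y. d x y * g (x, y) \<partial>lborel \<partial>lborel)"
      by (intro nn_integral_cong)
        (subst nn_integral_cmult[symmetric], measurable, simp add: d_def ennreal_mult mult.assoc)
    finally show ?thesis .
  qed
  have [measurable]: "(\<lambda>p. d (fst p) (snd p)) \<in> borel_measurable (borel \<Otimes>\<^sub>M borel)"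
    unfolding d_def by measurable
  show ?thesis
    using nn_integral_lborel_rotation[of "\<lambda>p. d (fst p) (snd p) * f p" c s, OF _ cs c]
      *[of f] *[of "\<lambda>(x, y). f (c * x - s * y, s * x + c * y)"]
    by (simp add: d_rot)
qed

text \<open>Polar coordinates. The sign condition on \<open>x\<close> lets \<open>c\<close> be
  chosen nonnegative, which avoids the excluded angle \<pi>; at the origin the trivial rotation is
  taken.\<close>

lemma ex_rotation_to_axis:
  assumes "0 \<le> (x::real)"
  obtains c s where "c\<^sup>2 + s\<^sup>2 = 1" "c \<noteq> -1" "x = sqrt (x\<^sup>2 + y\<^sup>2) * c" "y = sqrt (x\<^sup>2 + y\<^sup>2) * s"
proof (cases "x = 0 \<and> y = 0")
  case True
  then show ?thesis by (intro that[of 1 0]) auto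
next
  case False
  define n where "n = sqrt (x\<^sup>2 + y\<^sup>2)"
  have n: "n > 0" "n\<^sup>2 = x\<^sup>2 + y\<^sup>2" using False by (auto simp: n_def sum_power2_gt_zero_iff)
  have "(x / n)\<^sup>2 + (y / n)\<^sup>2 = 1"
    using n False by (simp add: power_divide add_divide_distrib[symmetric])
  moreover have "x / n \<ge> 0" using assms n by simp
  ultimately show ?thesis using n by (intro that[of "x / n" "y / n"]) (auto simp flip: n_def)
qed

text \<open>The rotation turns \<open>(a, b)\<close> onto the first axis: the first form then
  involves \<open>x\<close> alone, and the second keeps a component along the new \<open>y\<close>.
  This is the inductive step towards a triangular representation.\<close>

lemma nn_integral_std_normal_rotate:
  assumes [measurable]: "f \<in> borel_measurable (borel \<Otimes>\<^sub>M borel)"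
    and cs: "c\<^sup>2 + s\<^sup>2 = (1::real)" and c: "c \<noteq> -1"
    and a: "a = n * c" and b: "b = n * s"
  shows "(\<integral>\<^sup>+y. \<integral>\<^sup>+x. f (a * x + b * y, e * x + g * y) \<partial>std_normal \<partial>std_normal)
    = (\<integral>\<^sup>+y. \<integral>\<^sup>+x. f (n * x, (e * c + g * s) * x + (g * c - e * s) * y) \<partial>std_normal \<partial>std_normal)"
proof -
  have eq: "a * (c * x - s * y) + b * (s * x + c * y) = n * x" for x y
  proof -
    have "a * (c * x - s * y) + b * (s * x + c * y) = n * x * (c\<^sup>2 + s\<^sup>2)"
      unfolding a b by algebra
    then show ?thesis using cs by simp
  qed
  have eq2: "e * (c * x - s * y) + g * (s * x + c * y) = (e * c + g * s) * x + (g * c - e * s) * y" for x y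
    by algebra
  have "(\<integral>\<^sup>+y. \<integral>\<^sup>+x. f (a * x + b * y, e * x + g * y) \<partial>std_normal \<partial>std_normal)
    = (\<integral>\<^sup>+x. \<integral>\<^sup>+y. f (a * x + b * y, e * x + g * y) \<partial>std_normal \<partial>std_normal)"
    by (rule std_normal_pair.Fubini') measurable
  also have "\<dots> = (\<integral>\<^sup>+x. \<integral>\<^sup>+y. f (n * x, (e * c + g * s) * x + (g * c - e * s) * y) \<partial>std_normal \<partial>std_normal)"
    using nn_integral_std_normal_rotation[of "\<lambda>(x, y). f (a * x + b * y, e * x + g * y)" c s, OF _ cs c, symmetric]
    by (simp add: eq eq2)
  also have "\<dots> = (\<integral>\<^sup>+y. \<integral>\<^sup>+x. f (n * x, (e * c + g * s) * x + (g * c - e * s) * y) \<partial>std_normal \<partial>std_normal)"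
    by (rule std_normal_pair.Fubini'[symmetric]) measurable
  finally show ?thesis .
qed

lemma nn_integral_std_normal_add:
  assumes [measurable]: "f \<in> borel_measurable borel" and a: "0 \<le> a"
  shows "(\<integral>\<^sup>+y. \<integral>\<^sup>+x. f (a * x + b * y) \<partial>std_normal \<partial>std_normal) = (\<integral>\<^sup>+x. f (sqrt (a\<^sup>2 + b\<^sup>2) * x) \<partial>std_normal)"
proof -
  obtain c s where cs: "c\<^sup>2 + s\<^sup>2 = 1" "c \<noteq> -1" "a = sqrt (a\<^sup>2 + b\<^sup>2) * c" "b = sqrt (a\<^sup>2 + b\<^sup>2) * s"
    using ex_rotation_to_axis[OF a] by metis
  show ?thesis
    using nn_integral_std_normal_rotate[of "\<lambda>p. f (fst p)" c s, OF _ cs, of 0 0]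
    by (simp add: std_normal.emeasure_space_1[simplified])
qed

text \<open>Cholesky form of the joint law of two linear forms; the three equations are the entries
  of their Gram matrix. Quantifying \<open>\<gamma>\<close> existentially instead of dividing by
  \<open>\<alpha>\<close> covers the case where all \<open>a i\<close> vanish. The induction absorbs
  one new coordinate at a time by rotations.\<close>

lemma nn_integral_gauss_linear_pair:
  fixes a b :: "'i \<Rightarrow> real"
  assumes "finite I"
  shows "\<exists>\<alpha> \<gamma> \<delta>. 0 \<le> \<alpha> \<and> 0 \<le> \<delta> \<and> \<alpha>\<^sup>2 = (\<Sum>i\<in>I. (a i)\<^sup>2) \<and> \<alpha> * \<gamma> = (\<Sum>i\<in>I. a i * b i) \<and>
    \<gamma>\<^sup>2 + \<delta>\<^sup>2 = (\<Sum>i\<in>I. (b i)\<^sup>2) \<and>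
    (\<forall>f\<in>borel_measurable (borel \<Otimes>\<^sub>M borel).
      (\<integral>\<^sup>+z. f (\<Sum>i\<in>I. a i * z i, \<Sum>i\<in>I. b i * z i) \<partial>gauss I)
        = (\<integral>\<^sup>+x. \<integral>\<^sup>+y. f (\<alpha> * x, \<gamma> * x + \<delta> * y) \<partial>std_normal \<partial>std_normal))"
  using assms
proof (induction I rule: finite_induct)
  case empty
  interpret product_sigma_finite "\<lambda>i::'i. std_normal" ..
  have "emeasure (Pi\<^sub>M {} (\<lambda>i::'i. std_normal)) (space (Pi\<^sub>M {} (\<lambda>i. std_normal))) = 1"
    by (rule prob_space.emeasure_space_1) (rule prob_space_PiM, rule prob_space_std_normal)
  then show ?case
    by (intro exI[of _ 0]) (simp add: gauss_def std_normal.emeasure_space_1[simplified])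
next
  case (insert i I)
  interpret product_sigma_finite "\<lambda>i::'i. std_normal" ..
  from insert.IH obtain \<alpha> \<gamma> \<delta> where g: "0 \<le> \<alpha>" "0 \<le> \<delta>" "\<alpha>\<^sup>2 = (\<Sum>i\<in>I. (a i)\<^sup>2)" "\<alpha> * \<gamma> = (\<Sum>i\<in>I. a i * b i)"
    "\<gamma>\<^sup>2 + \<delta>\<^sup>2 = (\<Sum>i\<in>I. (b i)\<^sup>2)"
    and IH: "\<And>f. f\<in>borel_measurable (borel \<Otimes>\<^sub>M borel) \<Longrightarrow>
      (\<integral>\<^sup>+z. f (\<Sum>i\<in>I. a i * z i, \<Sum>i\<in>I. b i * z i) \<partial>gauss I)
        = (\<integral>\<^sup>+x. \<integral>\<^sup>+y. f (\<alpha> * x, \<gamma> * x + \<delta> * y) \<partial>std_normal \<partial>std_normal)"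
    by blast
  define \<alpha>' where "\<alpha>' = sqrt (\<alpha>\<^sup>2 + (a i)\<^sup>2)"
  obtain c s where cs: "c\<^sup>2 + s\<^sup>2 = 1" "c \<noteq> -1" "\<alpha> = \<alpha>' * c" "a i = \<alpha>' * s"
    using ex_rotation_to_axis[OF g(1)] unfolding \<alpha>'_def by metis
  define \<gamma>' where "\<gamma>' = \<gamma> * c + b i * s"
  \<comment> \<open>\<open>d\<close> is the weight left on the new coordinate in the second form
    after the rotation that removes it from the first.\<close>
  define d where "d = b i * c - \<gamma> * s"
  define \<delta>' where "\<delta>' = sqrt (\<delta>\<^sup>2 + d\<^sup>2)"
  have "\<alpha>' * \<gamma>' = \<alpha> * \<gamma> + a i * b i"
    unfolding \<gamma>'_def cs(3,4) by algebra
  moreover have "\<gamma>'\<^sup>2 + \<delta>'\<^sup>2 = \<gamma>\<^sup>2 + \<delta>\<^sup>2 + (b i)\<^sup>2"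
  proof -
    have "\<gamma>'\<^sup>2 + d\<^sup>2 = (\<gamma>\<^sup>2 + (b i)\<^sup>2) * (c\<^sup>2 + s\<^sup>2)"
      unfolding \<gamma>'_def d_def by algebra
    then show ?thesis using cs(1) by (simp add: \<delta>'_def)
  qed
  moreover have "(\<integral>\<^sup>+z. f (\<Sum>i\<in>insert i I. a i * z i, \<Sum>i\<in>insert i I. b i * z i) \<partial>gauss (insert i I))
        = (\<integral>\<^sup>+x. \<integral>\<^sup>+y. f (\<alpha>' * x, \<gamma>' * x + \<delta>' * y) \<partial>std_normal \<partial>std_normal)"
    if [measurable]: "f \<in> borel_measurable (borel \<Otimes>\<^sub>M borel)" for f
  proof -
    have *: "(\<Sum>j\<in>I. a j * (if j = i then y else z j)) = (\<Sum>j\<in>I. a j * z j)" for a z :: "'i \<Rightarrow> real" and y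
      using insert.hyps by (intro sum.cong) auto
    have "(\<integral>\<^sup>+z. f (\<Sum>i\<in>insert i I. a i * z i, \<Sum>i\<in>insert i I. b i * z i) \<partial>gauss (insert i I))
      = (\<integral>\<^sup>+w. \<integral>\<^sup>+z. f (a i * w + (\<Sum>i\<in>I. a i * z i), b i * w + (\<Sum>i\<in>I. b i * z i)) \<partial>gauss I \<partial>std_normal)"
      unfolding gauss_def using insert.hyps
      by (subst product_nn_integral_insert_rev) (auto simp: *)
    also have "\<dots> = (\<integral>\<^sup>+w. \<integral>\<^sup>+x. \<integral>\<^sup>+y. f (a i * w + \<alpha> * x, b i * w + (\<gamma> * x + \<delta> * y)) \<partial>std_normal \<partial>std_normal \<partial>std_normal)"
      by (intro nn_integral_cong IH[of "\<lambda>(x, y). f (a i * w + x, b i * w + y)" for w, simplified]) measurable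
    also have "\<dots> = (\<integral>\<^sup>+w. \<integral>\<^sup>+x. \<integral>\<^sup>+y. f (\<alpha> * x + a i * w, (\<gamma> * x + b i * w) + \<delta> * y) \<partial>std_normal \<partial>std_normal \<partial>std_normal)"
      by (simp add: algebra_simps)
    \<comment> \<open>Only \<open>(x, w)\<close> is rotated; the integral over \<open>y\<close> is
      treated as part of the integrand.\<close>
    also have "\<dots> = (\<integral>\<^sup>+w. \<integral>\<^sup>+x. \<integral>\<^sup>+y. f (\<alpha>' * x, (\<gamma>' * x + d * w) + \<delta> * y) \<partial>std_normal \<partial>std_normal \<partial>std_normal)"
      using nn_integral_std_normal_rotate[of "\<lambda>p. \<integral>\<^sup>+y. f (fst p, snd p + \<delta> * y) \<partial>std_normal" c s \<alpha> \<alpha>' "a i" \<gamma> "b i", OF _ cs]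
      by (simp add: \<gamma>'_def d_def)
    also have "\<dots> = (\<integral>\<^sup>+x. \<integral>\<^sup>+w. \<integral>\<^sup>+y. f (\<alpha>' * x, (\<gamma>' * x + d * w) + \<delta> * y) \<partial>std_normal \<partial>std_normal \<partial>std_normal)"
      by (rule std_normal_pair.Fubini') measurable
    also have "\<dots> = (\<integral>\<^sup>+x. \<integral>\<^sup>+w. \<integral>\<^sup>+y. f (\<alpha>' * x, \<gamma>' * x + (\<delta> * y + d * w)) \<partial>std_normal \<partial>std_normal \<partial>std_normal)"
      by (simp add: algebra_simps)
    \<comment> \<open>For fixed \<open>x\<close> the remaining noise
      \<open>\<delta> * y + d * w\<close> is a single centred normal of variance
      \<open>\<delta>'\<close> squared.\<close>
    also have "\<dots> = (\<integral>\<^sup>+x. \<integral>\<^sup>+y. f (\<alpha>' * x, \<gamma>' * x + \<delta>' * y) \<partial>std_normal \<partial>std_normal)"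
      unfolding \<delta>'_def
      by (intro nn_integral_cong nn_integral_std_normal_add[of "\<lambda>v. f (\<alpha>' * x, \<gamma>' * x + v)" for x]) (use g in measurable)
    finally show ?thesis .
  qed
  moreover have "0 \<le> \<alpha>'" "0 \<le> \<delta>'" "\<alpha>'\<^sup>2 = \<alpha>\<^sup>2 + (a i)\<^sup>2" by (simp_all add: \<alpha>'_def \<delta>'_def)
  ultimately show ?case
    using insert.hyps g by (intro exI[of _ \<alpha>'] exI[of _ \<gamma>'] exI[of _ \<delta>']) simp
qed

text \<open>Moves identities for nonnegative integrals, proved without integrability conditions, to
  equality of laws, from which Bochner integrals can be compared.\<close>

lemma distr_eqI_nn_integral:
  assumes "X \<in> measurable M N" "Y \<in> measurable M' N"
    and "\<And>f. f \<in> borel_measurable N \<Longrightarrow> (\<integral>\<^sup>+x. f (X x) \<partial>M) = (\<integral>\<^sup>+x. f (Y x) \<partial>M')"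
  shows "distr M N X = distr M' N Y"
proof (rule measure_eqI)
  fix A assume "A \<in> sets (distr M N X)"
  then have A[measurable]: "A \<in> sets N" by simp
  have "emeasure (distr M N X) A = (\<integral>\<^sup>+x. indicator A (X x) \<partial>M)"
    using assms(1) nn_integral_distr[of X M N "indicator A"] by simp
  also have "\<dots> = (\<integral>\<^sup>+x. indicator A (Y x) \<partial>M')"
    by (rule assms(3)) measurable
  also have "\<dots> = emeasure (distr M' N Y) A"
    using assms(2) nn_integral_distr[of Y M' N "indicator A"] by simp
  finally show "emeasure (distr M N X) A = emeasure (distr M' N Y) A" .
qed simp

section \<open>Bounded functions on probability spaces\<close>

lemma integrable_bounded_prob_space:
  fixes f :: "'a \<Rightarrow> real"
  assumes "prob_space M" "f \<in> borel_measurable M" "\<And>x. \<bar>f x\<bar> \<le> B"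
  shows "integrable M f"
proof -
  interpret prob_space M by fact
  show ?thesis using assms(2,3) by (intro integrable_const_bound[of _ B]) auto
qed

lemma abs_integral_le_prob_space:
  fixes f :: "'a \<Rightarrow> real"
  assumes "prob_space M" "\<And>x. \<bar>f x\<bar> \<le> B"
  shows "\<bar>\<integral>x. f x \<partial>M\<bar> \<le> B"
proof (cases "integrable M f")
  case True
  interpret prob_space M by fact
  have "\<bar>\<integral>x. f x \<partial>M\<bar> \<le> (\<integral>x. \<bar>f x\<bar> \<partial>M)" by simp
  also have "\<dots> \<le> (\<integral>x. B \<partial>M)" using True assms(2) by (intro integral_mono) auto
  finally show ?thesis by (simp add: prob_space)
next
  \<comment> \<open>A non-integrable function has Bochner integral 0 by convention, and the bound at
    any point gives \<open>0 \<le> B\<close>.\<close>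
  case False
  then show ?thesis using assms(2)[of undefined] by (simp add: not_integrable_integral_eq)
qed

lemma integrable_bounded_mult_prob_space:
  fixes f g :: "'a \<Rightarrow> real"
  assumes "prob_space M" "f \<in> borel_measurable M" "g \<in> borel_measurable M"
    and "\<And>x. \<bar>f x\<bar> \<le> B" "\<And>x. \<bar>g x\<bar> \<le> B"
  shows "integrable M (\<lambda>x. f x * g x)"
proof (rule integrable_bounded_prob_space[OF assms(1)])
  show "\<bar>f x * g x\<bar> \<le> B * B" for x
    unfolding abs_mult using assms(4)[of x] by (intro mult_mono assms(4,5)) auto
qed (use assms in measurable)

section \<open>Gaussian smoothing\<close>

text \<open>Convolution with a centred normal law of standard deviation \<open>s\<close>.
  Integrating against the standard normal law keeps \<open>s = 0\<close> meaningful: it returns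
  \<open>u\<close>. This degenerate case arises when two replicas coincide.\<close>

definition smooth :: "real \<Rightarrow> (real \<Rightarrow> real) \<Rightarrow> real \<Rightarrow> real" where
  "smooth s u x = (\<integral>t. u (x + s * t) \<partial>std_normal)"

lemma borel_measurable_smooth[measurable]:
  assumes [measurable]: "u \<in> borel_measurable borel"
  shows "smooth s u \<in> borel_measurable borel"
  unfolding smooth_def[abs_def] by measurable

lemma abs_smooth_le:
  assumes "\<And>t. \<bar>u t\<bar> \<le> M"
  shows "\<bar>smooth s u x\<bar> \<le> M"
  unfolding smooth_def by (intro abs_integral_le_prob_space prob_space_std_normal assms)

text \<open>The affine substitution \<open>x + s * t\<close> leads to the integral against a normal
  density that the theorem uses, and to densities whose affinity can be computed.\<close>

lemma smooth_eq_integral_normal_density: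
  assumes [measurable]: "u \<in> borel_measurable borel" and s: "0 < s"
  shows "smooth s u x = (\<integral>t. u t * normal_density x s t \<partial>lborel)"
proof -
  have *: "s * normal_density x s (x + s * t) = std_normal_density t" for t
    using s by (simp add: normal_density_def real_sqrt_mult power_mult_distrib field_simps)
  have "smooth s u x = (\<integral>t. std_normal_density t * u (x + s * t) \<partial>lborel)"
    unfolding smooth_def by (subst integral_density) auto
  also have "\<dots> = s * (\<integral>t. u (x + s * t) * normal_density x s (x + s * t) \<partial>lborel)"
    unfolding integral_mult_right_zero[symmetric] *[symmetric] by (simp add: ac_simps)
  also have "\<dots> = (\<integral>t. u t * normal_density x s t \<partial>lborel)"
    using s lborel_integral_real_affine[of s "\<lambda>t. u t * normal_density x s t" x] by simp
  finally show ?thesis .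
qed

section \<open>Total variation estimates between normal laws\<close>

lemma mult_le_square_mean: "x * y \<le> ((x + y) / 2)\<^sup>2" for x y :: real
  using zero_le_power2[of "x - y"] by (simp add: power2_eq_square field_simps)

text \<open>
  \<open>\<integral> h\<close> is the Hellinger affinity of \<open>f\<close> and \<open>g\<close>, and \<open>(f - g)\<^sup>2 = (f + g - 2 h) (f + g + 2 h)\<close>; AM-GM with
  weight \<open>D\<close> replaces the Cauchy-Schwarz inequality.
\<close>

lemma abs_integral_diff_le_affinity:
  fixes f g h u :: "real \<Rightarrow> real"
  assumes f: "integrable lborel f" "\<And>x. 0 \<le> f x" "(\<integral>x. f x \<partial>lborel) = 1"
    and g: "integrable lborel g" "\<And>x. 0 \<le> g x" "(\<integral>x. g x \<partial>lborel) = 1"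
    and h: "integrable lborel h" "\<And>x. 0 \<le> h x" "\<And>x. (h x)\<^sup>2 = f x * g x"
    and D: "0 < D" "1 - (\<integral>x. h x \<partial>lborel) \<le> D\<^sup>2"
    and u[measurable]: "u \<in> borel_measurable borel" and M: "\<And>x. \<bar>u x\<bar> \<le> M"
  shows "\<bar>(\<integral>x. u x * f x \<partial>lborel) - (\<integral>x. u x * g x \<partial>lborel)\<bar> \<le> 3 * M * D"
proof -
  let ?c = "\<integral>x. h x \<partial>lborel"
  have M0: "0 \<le> M" using M[of 0] by linarith
  have h_le: "2 * h x \<le> f x + g x" for x
  proof -
    have "(2 * h x)\<^sup>2 \<le> (f x + g x)\<^sup>2"
      using h(3)[of x] zero_le_power2[of "f x - g x"] by (simp add: power2_eq_square algebra_simps)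
    then show ?thesis using f(2) g(2) by (meson add_nonneg_nonneg power2_le_imp_le)
  qed
  have "2 * ?c \<le> (\<integral>x. f x \<partial>lborel) + (\<integral>x. g x \<partial>lborel)"
    using integral_mono[of lborel "\<lambda>x. 2 * h x" "\<lambda>x. f x + g x"] f(1) g(1) h(1) h_le by simp
  then have c1: "?c \<le> 1" using f(3) g(3) by simp
  have le: "\<bar>f x - g x\<bar> \<le> (f x + g x - 2 * h x) / (2 * D) + D * (f x + g x + 2 * h x) / 2" for x
  proof -
    let ?P = "f x + g x - 2 * h x" and ?Q = "f x + g x + 2 * h x"
    have P: "0 \<le> ?P" using h_le[of x] by simp
    have Q: "0 \<le> ?Q" using f(2) g(2) h(2) by simp
    have "(f x - g x)\<^sup>2 = ?P * ?Q" using h(3)[of x] by (simp add: power2_eq_square algebra_simps)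
    also have "\<dots> = (?P / D) * (D * ?Q)" using D by simp
    also have "\<dots> \<le> ((?P / D + D * ?Q) / 2)\<^sup>2"
      using mult_le_square_mean[of "?P / D" "D * ?Q"] .
    finally have "\<bar>f x - g x\<bar> \<le> \<bar>(?P / D + D * ?Q) / 2\<bar>" by (simp only: abs_le_square_iff)
    also have "\<dots> = (?P / D + D * ?Q) / 2" using P Q D by simp
    finally show ?thesis by (simp add: add_divide_distrib)
  qed
  have int: "integrable lborel (\<lambda>x. u x * k x)" if "integrable lborel k" for k
  proof (rule Bochner_Integration.integrable_bound[of _ "\<lambda>x. M * k x"])
    show "integrable lborel (\<lambda>x. M * k x)" using that by simp
    show "(\<lambda>x. u x * k x) \<in> borel_measurable lborel" using that by measurable
    show "AE x in lborel. norm (u x * k x) \<le> norm (M * k x)"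
      using M M0 by (auto simp: abs_mult intro!: mult_right_mono)
  qed
  have "\<bar>(\<integral>x. u x * f x \<partial>lborel) - (\<integral>x. u x * g x \<partial>lborel)\<bar> = \<bar>\<integral>x. u x * (f x - g x) \<partial>lborel\<bar>"
    using int[OF f(1)] int[OF g(1)] by (simp add: right_diff_distrib)
  also have "\<dots> \<le> (\<integral>x. \<bar>u x * (f x - g x)\<bar> \<partial>lborel)" by simp
  also have "\<dots> \<le> (\<integral>x. M * ((f x + g x - 2 * h x) / (2 * D) + D * (f x + g x + 2 * h x) / 2) \<partial>lborel)"
  proof (rule integral_mono)
    show "integrable lborel (\<lambda>x. \<bar>u x * (f x - g x)\<bar>)"
      using int[of "\<lambda>x. f x - g x"] f(1) g(1) by simp
    show "integrable lborel (\<lambda>x. M * ((f x + g x - 2 * h x) / (2 * D) + D * (f x + g x + 2 * h x) / 2))"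
      using f(1) g(1) h(1) by simp
    show "\<bar>u x * (f x - g x)\<bar> \<le> M * ((f x + g x - 2 * h x) / (2 * D) + D * (f x + g x + 2 * h x) / 2)" for x
      unfolding abs_mult using M le by (intro mult_mono) (auto intro: M0)
  qed
  also have "\<dots> = M * ((2 - 2 * ?c) / (2 * D) + D * (2 + 2 * ?c) / 2)"
    using f(1,3) g(1,3) h(1) by simp
  also have "\<dots> = M * ((1 - ?c) / D + D * (1 + ?c))"
    using D(1) by (simp add: add_divide_distrib diff_divide_distrib distrib_left right_diff_distrib)
  \<comment> \<open>The factor 3 is 1 from the assumed bound on the affinity defect plus 2 from
    \<open>?c \<le> 1\<close>.\<close>
  also have "\<dots> \<le> M * (D + D * 2)"
  proof (intro mult_left_mono add_mono M0)
    show "(1 - ?c) / D \<le> D" using D by (simp add: divide_le_eq power2_eq_square)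
  qed (use c1 D in auto)
  finally show ?thesis by (simp add: algebra_simps)
qed

text \<open>The geometric mean of two normal densities of equal variance is a multiple of the one
  centred at the midpoint; the multiple is the affinity, and 1 - exp(-y) \<le> y bounds its defect.
  Equal means are split off because the affinity bound wants \<open>D\<close> positive.\<close>

lemma abs_smooth_diff_mean_le:
  assumes [measurable]: "u \<in> borel_measurable borel" and M: "\<And>x. \<bar>u x\<bar> \<le> M" and s: "0 < s"
  shows "\<bar>smooth s u a - smooth s u b\<bar> \<le> 3 * M * (\<bar>a - b\<bar> / s)"
proof (cases "a = b")
  case False
  let ?c = "exp (- (a - b)\<^sup>2 / (8 * s\<^sup>2))"
  show ?thesis
    unfolding smooth_eq_integral_normal_density[OF assms(1) s]
  proof (rule abs_integral_diff_le_affinity[where h = "\<lambda>x. ?c * normal_density ((a + b) / 2) s x"])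
    show "(?c * normal_density ((a + b) / 2) s x)\<^sup>2 = normal_density a s x * normal_density b s x" for x
    proof -
      have 1: "2 * (- (a - b)\<^sup>2 / (8 * s\<^sup>2) + - (x - (a + b) / 2)\<^sup>2 / (2 * s\<^sup>2))
        = - (x - a)\<^sup>2 / (2 * s\<^sup>2) + - (x - b)\<^sup>2 / (2 * s\<^sup>2)"
        using s by (simp add: field_simps power2_eq_square)
      have "(?c * normal_density ((a + b) / 2) s x)\<^sup>2
        = exp (2 * (- (a - b)\<^sup>2 / (8 * s\<^sup>2) + - (x - (a + b) / 2)\<^sup>2 / (2 * s\<^sup>2))) / (2 * pi * s\<^sup>2)"
        unfolding exp_double exp_add by (simp add: normal_density_def power_mult_distrib power_divide)
      also have "\<dots> = normal_density a s x * normal_density b s x"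
        unfolding 1 exp_add using s by (simp add: normal_density_def)
      finally show ?thesis .
    qed
    have "1 - ?c \<le> (a - b)\<^sup>2 / (8 * s\<^sup>2)"
      using exp_ge_add_one_self[of "- (a - b)\<^sup>2 / (8 * s\<^sup>2)"] by simp
    also have "\<dots> \<le> (\<bar>a - b\<bar> / s)\<^sup>2"
      using s by (simp add: power_divide frac_le)
    finally show "1 - (\<integral>x. ?c * normal_density ((a + b) / 2) s x \<partial>lborel) \<le> (\<bar>a - b\<bar> / s)\<^sup>2"
      using s by simp
  qed (use s False M in auto)
qed (use s in auto)

text \<open>For a common mean the geometric mean is \<open>c\<close> times a normal density whose
  variance is the harmonic mean of s^2 and t^2, so \<open>c\<close> is the affinity.\<close>

lemma abs_smooth_diff_scale_le:
  assumes [measurable]: "u \<in> borel_measurable borel" and M: "\<And>x. \<bar>u x\<bar> \<le> M" and t: "0 < t" and s: "0 \<le> s"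
  shows "\<bar>smooth s u a - smooth t u a\<bar> \<le> 3 * M * (\<bar>s - t\<bar> / t)"
proof -
  consider "s = 0" | "s = t" | "s > 0" "s \<noteq> t" using s by linarith
  then show ?thesis
  proof cases
    \<comment> \<open>At \<open>s = 0\<close> there is no density, but the right-hand side equals 3
      M, above the trivial bound 2 M.\<close>
    case 1
    have "\<bar>smooth s u a - smooth t u a\<bar> \<le> M + M"
      by (intro order_trans[OF abs_triangle_ineq4] add_mono abs_smooth_le M)
    then show ?thesis using 1 t M[of 0] by simp
  next
    case 3
    let ?n = "s\<^sup>2 + t\<^sup>2"
    define c where "c = sqrt (2 * s * t / ?n)"
    define v where "v = sqrt (2 * s\<^sup>2 * t\<^sup>2 / ?n)"
    have n: "?n > 0" using t by (simp add: add_nonneg_pos)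
    have c: "c \<ge> 0" "c\<^sup>2 = 2 * s * t / ?n" using 3 t n by (auto simp: c_def)
    have v: "v > 0" "v\<^sup>2 = 2 * s\<^sup>2 * t\<^sup>2 / ?n" using 3 t n by (auto simp: v_def)
    have "1 - c\<^sup>2 = (s - t)\<^sup>2 / ?n"
    proof -
      have "(1 - c\<^sup>2) * ?n = ?n - 2 * s * t" unfolding c using n by (simp add: left_diff_distrib)
      also have "\<dots> = (s - t)\<^sup>2" by (simp add: power2_eq_square algebra_simps)
      finally show ?thesis using n by (simp add: eq_divide_eq del: sum_power2_eq_zero_iff)
    qed
    \<comment> \<open>Passing to the square of \<open>c\<close> removes the square root from the
      affinity; this uses \<open>0 \<le> c\<close> and \<open>c \<le> 1\<close>.\<close>
    moreover have "1 - c \<le> 1 - c\<^sup>2"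
    proof -
      have "2 * s * t \<le> ?n" using zero_le_power2[of "s - t"] by (simp add: power2_eq_square algebra_simps)
      then have "c \<le> 1" unfolding c_def using n by simp
      then show ?thesis using c(1) by (simp add: power2_eq_square mult_left_le)
    qed
    moreover have "(s - t)\<^sup>2 / ?n \<le> (\<bar>s - t\<bar> / t)\<^sup>2"
      using t by (simp add: power_divide frac_le)
    ultimately have c_le: "1 - c \<le> (\<bar>s - t\<bar> / t)\<^sup>2" by linarith
    show ?thesis
      unfolding smooth_eq_integral_normal_density[OF assms(1) 3(1)] smooth_eq_integral_normal_density[OF assms(1) t]
    proof (rule abs_integral_diff_le_affinity[where h = "\<lambda>x. c * normal_density a v x"])
      show "(c * normal_density a v x)\<^sup>2 = normal_density a s x * normal_density a t x" for x
      proof -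
        have 1: "- (x - a)\<^sup>2 / (2 * v\<^sup>2) + - (x - a)\<^sup>2 / (2 * v\<^sup>2) = - (x - a)\<^sup>2 / (2 * s\<^sup>2) + - (x - a)\<^sup>2 / (2 * t\<^sup>2)"
          unfolding v using 3 t n by (simp add: field_simps)
        have sqrt2: "sqrt 2 * (sqrt pi * (sqrt 2 * sqrt pi)) = 2 * pi"
          by (simp add: mult.left_commute mult.assoc[symmetric])
        have "2 * s * t / k * (1 / (2 * pi * (2 * s\<^sup>2 * t\<^sup>2 / k))) = 1 / (2 * pi * s * t)" if "k > 0" for k
          using that 3 t by (simp add: field_simps power2_eq_square)
        then have 2: "c\<^sup>2 * (1 / (2 * pi * v\<^sup>2)) = 1 / (2 * pi * s * t)"
          unfolding v c using n by blast
        have "(c * normal_density a v x)\<^sup>2 = c\<^sup>2 * (1 / (2 * pi * v\<^sup>2)) * exp (- (x - a)\<^sup>2 / (2 * v\<^sup>2) + - (x - a)\<^sup>2 / (2 * v\<^sup>2))"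
          unfolding exp_add using v(1) by (simp add: normal_density_def power_mult_distrib power_divide power2_eq_square[of "exp _"])
        also have "\<dots> = normal_density a s x * normal_density a t x"
          using 3 t sqrt2 unfolding 1 2
          unfolding exp_add by (simp add: normal_density_def real_sqrt_mult)
        finally show ?thesis .
      qed
    qed (use t v 3 M c c_le in auto)
  qed simp
qed

text \<open>The scale is changed first, at \<open>a\<close>; the mean is then moved at the positive
  scale \<open>t\<close>, so \<open>s\<close> may vanish.\<close>

lemma abs_smooth_diff_le:
  assumes "u \<in> borel_measurable borel" and M: "\<And>x. \<bar>u x\<bar> \<le> M" and "0 < t" and "0 \<le> s"
  shows "\<bar>smooth s u a - smooth t u b\<bar> \<le> 3 * M * ((\<bar>s - t\<bar> + \<bar>a - b\<bar>) / t)"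
  using abs_smooth_diff_scale_le[OF assms, of a] abs_smooth_diff_mean_le[OF assms(1-3), of a b]
  by (simp add: add_divide_distrib distrib_left)

text \<open>Semigroup property: independent normal noises add up and so do their variances.\<close>

lemma smooth_smooth:
  assumes [measurable]: "u \<in> borel_measurable borel" and M: "\<And>x. \<bar>u x\<bar> \<le> M" and s: "0 \<le> s"
  shows "smooth s (smooth t u) x = smooth (sqrt (t\<^sup>2 + s\<^sup>2)) u x"
proof -
  have *: "distr (std_normal \<Otimes>\<^sub>M std_normal) borel (\<lambda>p. s * fst p + t * snd p)
    = distr std_normal borel (\<lambda>y. sqrt (t\<^sup>2 + s\<^sup>2) * y)"
  proof (rule distr_eqI_nn_integral)
    fix f :: "real \<Rightarrow> ennreal" assume [measurable]: "f \<in> borel_measurable borel"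
    have "(\<integral>\<^sup>+p. f (s * fst p + t * snd p) \<partial>(std_normal \<Otimes>\<^sub>M std_normal)) =
      (\<integral>\<^sup>+y. \<integral>\<^sup>+x. f (s * x + t * y) \<partial>std_normal \<partial>std_normal)"
      by (subst std_normal_pair.nn_integral_snd[symmetric]) auto
    also have "\<dots> = (\<integral>\<^sup>+y. f (sqrt (t\<^sup>2 + s\<^sup>2) * y) \<partial>std_normal)"
      using s by (simp add: nn_integral_std_normal_add add.commute)
    finally show "(\<integral>\<^sup>+p. f (s * fst p + t * snd p) \<partial>(std_normal \<Otimes>\<^sub>M std_normal))
      = (\<integral>\<^sup>+y. f (sqrt (t\<^sup>2 + s\<^sup>2) * y) \<partial>std_normal)" .
  qed auto
  have "smooth s (smooth t u) x = (\<integral>a. \<integral>b. u (x + (s * a + t * b)) \<partial>std_normal \<partial>std_normal)"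
    by (simp add: smooth_def add.assoc)
  also have "\<dots> = (\<integral>p. u (x + (s * fst p + t * snd p)) \<partial>(std_normal \<Otimes>\<^sub>M std_normal))"
    by (subst std_normal_pair.integral_fst'[symmetric])
      (auto intro!: integrable_bounded_prob_space[OF _ _ M] std_normal_pair.prob_space_axioms)
  also have "\<dots> = (\<integral>y. u (x + y) \<partial>distr (std_normal \<Otimes>\<^sub>M std_normal) borel (\<lambda>p. s * fst p + t * snd p))"
    by (subst integral_distr) auto
  also have "\<dots> = smooth (sqrt (t\<^sup>2 + s\<^sup>2)) u x"
    unfolding * smooth_def by (subst integral_distr) auto
  finally show ?thesis .
qed

section \<open>Expectations of functions of Gaussian linear forms\<close>

lemma prob_space_gauss: "prob_space (gauss I)"
  unfolding gauss_def by (intro prob_space_PiM prob_space_std_normal)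

lemma measurable_gauss_component:
  "i \<in> I \<Longrightarrow> (\<lambda>z. z i) \<in> borel_measurable (gauss I)"
  unfolding gauss_def using measurable_component_singleton[of i I "\<lambda>_. std_normal"] by simp

lemma borel_measurable_gauss_linear[measurable]:
  "(\<lambda>z. \<Sum>i\<in>I. a i * z i) \<in> borel_measurable (gauss I)"
  by (intro borel_measurable_sum borel_measurable_times borel_measurable_const measurable_gauss_component)

text \<open>The pair lemma with the same form twice, tested on functions of the first
  coordinate.\<close>

lemma distr_gauss_linear:
  assumes "finite I"
  shows "distr (gauss I) borel (\<lambda>z. \<Sum>i\<in>I. a i * z i) = distr std_normal borel (\<lambda>x. sqrt (\<Sum>i\<in>I. (a i)\<^sup>2) * x)"
proof -
  from nn_integral_gauss_linear_pair[OF assms, of a a] obtain \<alpha> where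
    \<alpha>: "0 \<le> \<alpha>" "\<alpha>\<^sup>2 = (\<Sum>i\<in>I. (a i)\<^sup>2)" and
    eq: "\<And>f. f\<in>borel_measurable (borel \<Otimes>\<^sub>M borel) \<Longrightarrow> \<exists>\<gamma> \<delta>.
      (\<integral>\<^sup>+z. f (\<Sum>i\<in>I. a i * z i, \<Sum>i\<in>I. a i * z i) \<partial>gauss I)
        = (\<integral>\<^sup>+x. \<integral>\<^sup>+y. f (\<alpha> * x, \<gamma> * x + \<delta> * y) \<partial>std_normal \<partial>std_normal)"
    by blast
  have [simp]: "sqrt (\<Sum>i\<in>I. (a i)\<^sup>2) = \<alpha>" unfolding \<alpha>(2)[symmetric] using \<alpha>(1) by simp
  show ?thesis
  proof (rule distr_eqI_nn_integral)
    fix f :: "real \<Rightarrow> ennreal" assume [measurable]: "f \<in> borel_measurable borel"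
    show "(\<integral>\<^sup>+z. f (\<Sum>i\<in>I. a i * z i) \<partial>gauss I) = (\<integral>\<^sup>+x. f (sqrt (\<Sum>i\<in>I. (a i)\<^sup>2) * x) \<partial>std_normal)"
      using eq[of "\<lambda>p. f (fst p)"] by (auto simp: std_normal.emeasure_space_1[simplified])
  qed auto
qed

text \<open>Conditioning on the first form, normalized to unit variance: given its value
  \<open>x\<close>, the second is normal with mean \<open>\<gamma> * x\<close> and variance reduced
  by \<gamma>^2. The expectation thus becomes an iterated smoothing.\<close>

lemma integral_gauss_linear_pair:
  fixes a b :: "'i \<Rightarrow> real"
  assumes "finite I" and a: "(\<Sum>i\<in>I. (a i)\<^sup>2) = 1"
    and [measurable]: "u \<in> borel_measurable borel" "v \<in> borel_measurable borel"
    and M: "\<And>x. \<bar>u x\<bar> \<le> M" "\<And>x. \<bar>v x\<bar> \<le> M"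
    and \<gamma>: "\<gamma> = (\<Sum>i\<in>I. a i * b i)"
  shows "(\<integral>z. u (\<Sum>i\<in>I. a i * z i) * v (\<Sum>i\<in>I. b i * z i) \<partial>gauss I)
    = smooth 1 (\<lambda>x. u x * smooth (sqrt ((\<Sum>i\<in>I. (b i)\<^sup>2) - \<gamma>\<^sup>2)) v (\<gamma> * x)) 0"
proof -
  from nn_integral_gauss_linear_pair[OF assms(1), of a b] obtain \<alpha> \<gamma>' \<delta> where
    *: "0 \<le> \<alpha>" "0 \<le> \<delta>" "\<alpha>\<^sup>2 = (\<Sum>i\<in>I. (a i)\<^sup>2)" "\<alpha> * \<gamma>' = (\<Sum>i\<in>I. a i * b i)"
      "\<gamma>'\<^sup>2 + \<delta>\<^sup>2 = (\<Sum>i\<in>I. (b i)\<^sup>2)" and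
    eq: "\<And>f. f\<in>borel_measurable (borel \<Otimes>\<^sub>M borel) \<Longrightarrow>
      (\<integral>\<^sup>+z. f (\<Sum>i\<in>I. a i * z i, \<Sum>i\<in>I. b i * z i) \<partial>gauss I)
        = (\<integral>\<^sup>+x. \<integral>\<^sup>+y. f (\<alpha> * x, \<gamma>' * x + \<delta> * y) \<partial>std_normal \<partial>std_normal)"
    by blast
  have \<alpha>: "\<alpha> = 1" using * a by (simp add: power2_eq_1_iff)
  have \<gamma>': "\<gamma>' = \<gamma>" using * \<alpha> \<gamma> by simp
  have \<delta>: "sqrt ((\<Sum>i\<in>I. (b i)\<^sup>2) - \<gamma>\<^sup>2) = \<delta>" using *(5)[symmetric] *(2) \<gamma>' by simp
  have d: "distr (gauss I) (borel \<Otimes>\<^sub>M borel) (\<lambda>z. (\<Sum>i\<in>I. a i * z i, \<Sum>i\<in>I. b i * z i))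
    = distr (std_normal \<Otimes>\<^sub>M std_normal) (borel \<Otimes>\<^sub>M borel) (\<lambda>p. (fst p, \<gamma> * fst p + \<delta> * snd p))"
  proof (rule distr_eqI_nn_integral)
    fix f :: "real \<times> real \<Rightarrow> ennreal" assume [measurable]: "f \<in> borel_measurable (borel \<Otimes>\<^sub>M borel)"
    show "(\<integral>\<^sup>+z. f (\<Sum>i\<in>I. a i * z i, \<Sum>i\<in>I. b i * z i) \<partial>gauss I)
      = (\<integral>\<^sup>+p. f (fst p, \<gamma> * fst p + \<delta> * snd p) \<partial>(std_normal \<Otimes>\<^sub>M std_normal))"
      by (subst std_normal.nn_integral_fst[symmetric]) (simp_all add: eq \<alpha> \<gamma>')
  qed (measurable, measurable)
  have "(\<integral>z. u (\<Sum>i\<in>I. a i * z i) * v (\<Sum>i\<in>I. b i * z i) \<partial>gauss I)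
    = (\<integral>p. u (fst p) * v (snd p) \<partial>distr (gauss I) (borel \<Otimes>\<^sub>M borel) (\<lambda>z. (\<Sum>i\<in>I. a i * z i, \<Sum>i\<in>I. b i * z i)))"
    by (subst integral_distr) auto
  also have "\<dots> = (\<integral>p. u (fst p) * v (\<gamma> * fst p + \<delta> * snd p) \<partial>(std_normal \<Otimes>\<^sub>M std_normal))"
    unfolding d by (subst integral_distr) auto
  also have "\<dots> = (\<integral>x. \<integral>y. u x * v (\<gamma> * x + \<delta> * y) \<partial>std_normal \<partial>std_normal)"
    using M by (subst std_normal_pair.integral_fst'[symmetric])
      (simp_all add: integrable_bounded_mult_prob_space[where B = M] std_normal_pair.prob_space_axioms)
  also have "\<dots> = smooth 1 (\<lambda>x. u x * smooth (sqrt ((\<Sum>i\<in>I. (b i)\<^sup>2) - \<gamma>\<^sup>2)) v (\<gamma> * x)) 0"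
    by (simp add: smooth_def \<delta>)
  finally show ?thesis .
qed

text \<open>Reverses the order of conditioning in the pair
  \<open>(r \<xi> + t \<eta>, r \<xi>)\<close>. On the left the sum is smoothed given
  \<open>r \<xi>\<close>; on the right \<open>r \<xi>\<close> is smoothed given the sum, with
  regression coefficient r^2/\<alpha>^2 and residual deviation r t/\<alpha>.\<close>

lemma smooth_mult_smooth:
  assumes [measurable]: "u \<in> borel_measurable borel" "v \<in> borel_measurable borel"
    and M: "\<And>x. \<bar>u x\<bar> \<le> M" "\<And>x. \<bar>v x\<bar> \<le> M" and t: "0 < t" and \<alpha>: "\<alpha> = sqrt (r\<^sup>2 + t\<^sup>2)"
  shows "smooth r (\<lambda>x. smooth t u x * v x) 0 = smooth \<alpha> (\<lambda>x. u x * smooth (r * t / \<alpha>) v (r\<^sup>2 / \<alpha>\<^sup>2 * x)) 0"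
proof -
  have \<alpha>2: "\<alpha>\<^sup>2 = r\<^sup>2 + t\<^sup>2" using \<alpha> by simp
  have \<alpha>0: "\<alpha> > 0" using t \<alpha> by (simp add: add_nonneg_pos)
  \<comment> \<open>This rotation places the sum \<open>r \<xi> + t \<eta>\<close> on the second
    axis; \<open>0 < t\<close> makes \<open>c\<close> positive.\<close>
  define c where "c = t / \<alpha>"
  define s where "s = - r / \<alpha>"
  have "c\<^sup>2 + s\<^sup>2 = (r\<^sup>2 + t\<^sup>2) / \<alpha>\<^sup>2" by (simp add: c_def s_def power_divide add_divide_distrib)
  then have cs: "c\<^sup>2 + s\<^sup>2 = 1" using \<alpha>0 by (simp flip: \<alpha>2)
  have "c > 0" using t \<alpha>0 by (simp add: c_def)
  then have c: "c \<noteq> -1" by simp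
  have e1: "r * (c * x - s * y) + t * (s * x + c * y) = \<alpha> * y" for x y
  proof -
    have "r * (c * x - s * y) + t * (s * x + c * y) = (r\<^sup>2 + t\<^sup>2) / \<alpha> * y"
      by (simp add: c_def s_def field_simps power2_eq_square add_divide_distrib)
    also have "\<dots> = \<alpha> * y" unfolding \<alpha>2[symmetric] by (simp add: power2_eq_square)
    finally show ?thesis .
  qed
  have e2: "r * (c * x - s * y) = r * t / \<alpha> * x + r\<^sup>2 / \<alpha> * y" for x y
    by (simp add: c_def s_def algebra_simps power2_eq_square)
  have e: "(r * (c * x - s * y) + t * (s * x + c * y), r * (c * x - s * y))
    = (\<alpha> * y, r * t / \<alpha> * x + r\<^sup>2 / \<alpha> * y)" for x y
    by (simp only: e1, simp only: e2)
  have d: "distr (std_normal \<Otimes>\<^sub>M std_normal) (borel \<Otimes>\<^sub>M borel) (\<lambda>p. (r * fst p + t * snd p, r * fst p))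
    = distr (std_normal \<Otimes>\<^sub>M std_normal) (borel \<Otimes>\<^sub>M borel) (\<lambda>p. (\<alpha> * snd p, r * t / \<alpha> * fst p + r\<^sup>2 / \<alpha> * snd p))"
  proof (rule distr_eqI_nn_integral)
    fix f :: "real \<times> real \<Rightarrow> ennreal" assume [measurable]: "f \<in> borel_measurable (borel \<Otimes>\<^sub>M borel)"
    show "(\<integral>\<^sup>+p. f (r * fst p + t * snd p, r * fst p) \<partial>(std_normal \<Otimes>\<^sub>M std_normal))
      = (\<integral>\<^sup>+p. f (\<alpha> * snd p, r * t / \<alpha> * fst p + r\<^sup>2 / \<alpha> * snd p) \<partial>(std_normal \<Otimes>\<^sub>M std_normal))"
      using nn_integral_std_normal_rotation[of "\<lambda>p. f (r * fst p + t * snd p, r * fst p)" c s, OF _ cs c]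
      unfolding fst_conv snd_conv e
      by (simp flip: std_normal.nn_integral_fst)
  qed (measurable, measurable)
  have int: "integrable (std_normal \<Otimes>\<^sub>M std_normal) (\<lambda>p. u (f p) * v (g p))"
    if [measurable]: "f \<in> borel_measurable (borel \<Otimes>\<^sub>M borel)" "g \<in> borel_measurable (borel \<Otimes>\<^sub>M borel)" for f g
    using M by (intro integrable_bounded_mult_prob_space[where B = M] std_normal_pair.prob_space_axioms) auto
  have "smooth r (\<lambda>x. smooth t u x * v x) 0 = (\<integral>x. \<integral>y. u (r * x + t * y) * v (r * x) \<partial>std_normal \<partial>std_normal)"
    by (simp add: smooth_def)
  also have "\<dots> = (\<integral>p. u (r * fst p + t * snd p) * v (r * fst p) \<partial>(std_normal \<Otimes>\<^sub>M std_normal))"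
    by (subst std_normal_pair.integral_fst'[symmetric]) (simp_all add: int)
  also have "\<dots> = (\<integral>p. u (fst p) * v (snd p) \<partial>distr (std_normal \<Otimes>\<^sub>M std_normal) (borel \<Otimes>\<^sub>M borel) (\<lambda>p. (r * fst p + t * snd p, r * fst p)))"
    by (subst integral_distr) auto
  also have "\<dots> = (\<integral>p. u (\<alpha> * snd p) * v (r * t / \<alpha> * fst p + r\<^sup>2 / \<alpha> * snd p) \<partial>(std_normal \<Otimes>\<^sub>M std_normal))"
    unfolding d by (subst integral_distr) auto
  also have "\<dots> = (\<integral>y. \<integral>x. u (\<alpha> * y) * v (r * t / \<alpha> * x + r\<^sup>2 / \<alpha> * y) \<partial>std_normal \<partial>std_normal)"
    using std_normal_pair.integral_snd[of "\<lambda>x y. u (\<alpha> * y) * v (r * t / \<alpha> * x + r\<^sup>2 / \<alpha> * y)"]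
    by (simp add: int case_prod_beta')
  also have "\<dots> = smooth \<alpha> (\<lambda>x. u x * smooth (r * t / \<alpha>) v (r\<^sup>2 / \<alpha>\<^sup>2 * x)) 0"
    using \<alpha>0 by (simp add: smooth_def add.commute power2_eq_square mult.assoc)
  finally show ?thesis .
qed

text \<open>Follows from \<bar>x\<bar> \<le> (1 + x^2)/2 and the unit second moment.\<close>

lemma integral_abs_std_normal_le: "integrable std_normal (\<lambda>x. \<bar>x\<bar>)" "(\<integral>x. \<bar>x\<bar> \<partial>std_normal) \<le> 1"
proof -
  have i: "integrable lborel (\<lambda>x. std_normal_density x * x\<^sup>2)"
    using integrable_std_normal_moment[of 2] by simp
  have m: "(\<integral>x. std_normal_density x * x\<^sup>2 \<partial>lborel) = 1"
    using integral_std_normal_moment_even[of 1] by (simp add: has_bochner_integral_iff numeral_2_eq_2)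
  show int: "integrable std_normal (\<lambda>x. \<bar>x\<bar>)"
    using integrable_std_normal_moment_abs[of 1] by (subst integrable_density) (auto simp: ac_simps)
  have i2: "integrable std_normal (\<lambda>x. x\<^sup>2)" using i by (subst integrable_density) auto
  have "(\<integral>x. \<bar>x\<bar> \<partial>std_normal) \<le> (\<integral>x. (1 + x\<^sup>2) / 2 \<partial>std_normal)"
  proof (rule integral_mono[OF int])
    show "integrable std_normal (\<lambda>x. (1 + x\<^sup>2) / 2)" using i2 by simp
    show "\<bar>x\<bar> \<le> (1 + x\<^sup>2) / 2" for x :: real
      using zero_le_power2[of "\<bar>x\<bar> - 1"] by (simp add: power2_eq_square algebra_simps)
  qed
  also have "\<dots> = 1"
    using i2 m by (simp add: integral_density std_normal.prob_space[simplified])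
  finally show "(\<integral>x. \<bar>x\<bar> \<partial>std_normal) \<le> 1" .
qed

text \<open>First the outer scale moves from \<open>\<alpha>\<close> to 1 with the integrand,
  bounded by M^2, kept fixed; then the inner smoothing changes. There the centres differ by
  \<bar>\<kappa> - \<rho>\<bar> \<bar>x\<bar>, and the mean of \<bar>x\<bar> is at most 1.\<close>

lemma abs_smooth_mult_smooth_diff_le:
  assumes [measurable]: "u \<in> borel_measurable borel" and M: "\<And>x. \<bar>u x\<bar> \<le> M"
    and \<alpha>: "0 \<le> \<alpha>" and s: "0 \<le> s" and t: "0 < t"
  shows "\<bar>smooth \<alpha> (\<lambda>x. u x * smooth s u (\<kappa> * x)) 0 - smooth 1 (\<lambda>x. u x * smooth t u (\<rho> * x)) 0\<bar>
    \<le> 3 * M\<^sup>2 * (\<bar>\<alpha> - 1\<bar> + (\<bar>s - t\<bar> + \<bar>\<kappa> - \<rho>\<bar>) / t)"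
proof -
  let ?F = "\<lambda>x. u x * smooth s u (\<kappa> * x)" and ?G = "\<lambda>x. u x * smooth t u (\<rho> * x)"
  have M0: "0 \<le> M" using M[of 0] by linarith
  have b: "\<bar>u x * smooth s u y\<bar> \<le> M\<^sup>2" for x y s
    unfolding abs_mult power2_eq_square by (intro mult_mono M abs_smooth_le M0 abs_ge_zero)
  have "\<bar>smooth \<alpha> ?F 0 - smooth 1 ?F 0\<bar> \<le> 3 * M\<^sup>2 * (\<bar>\<alpha> - 1\<bar> / 1)"
    by (rule abs_smooth_diff_scale_le) (auto intro: b \<alpha>)
  moreover have "\<bar>smooth 1 ?F 0 - smooth 1 ?G 0\<bar> \<le> 3 * M\<^sup>2 * ((\<bar>s - t\<bar> + \<bar>\<kappa> - \<rho>\<bar>) / t)"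
  proof -
    have i: "integrable std_normal ?F" "integrable std_normal ?G"
      by (auto intro!: integrable_bounded_prob_space[where B = "M\<^sup>2"] prob_space_std_normal b)
    have "\<bar>smooth 1 ?F 0 - smooth 1 ?G 0\<bar> = \<bar>\<integral>x. ?F x - ?G x \<partial>std_normal\<bar>"
      using i by (simp add: smooth_def[of 1])
    also have "\<dots> \<le> (\<integral>x. \<bar>?F x - ?G x\<bar> \<partial>std_normal)" by simp
    also have "\<dots> \<le> (\<integral>x. 3 * M\<^sup>2 * ((\<bar>s - t\<bar> + \<bar>\<kappa> - \<rho>\<bar> * \<bar>x\<bar>) / t) \<partial>std_normal)"
    proof (rule integral_mono)
      show "integrable std_normal (\<lambda>x. \<bar>?F x - ?G x\<bar>)" using i by simp
      show "integrable std_normal (\<lambda>x. 3 * M\<^sup>2 * ((\<bar>s - t\<bar> + \<bar>\<kappa> - \<rho>\<bar> * \<bar>x\<bar>) / t))"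
        using integral_abs_std_normal_le(1) by simp
      fix x
      have "\<bar>?F x - ?G x\<bar> = \<bar>u x\<bar> * \<bar>smooth s u (\<kappa> * x) - smooth t u (\<rho> * x)\<bar>"
        by (simp add: abs_mult[symmetric] right_diff_distrib)
      also have "\<dots> \<le> M * (3 * M * ((\<bar>s - t\<bar> + \<bar>\<kappa> * x - \<rho> * x\<bar>) / t))"
        by (intro mult_mono M abs_smooth_diff_le s t M0) auto
      also have "\<dots> = 3 * M\<^sup>2 * ((\<bar>s - t\<bar> + \<bar>\<kappa> - \<rho>\<bar> * \<bar>x\<bar>) / t)"
        by (simp add: abs_mult[symmetric] left_diff_distrib power2_eq_square)
      finally show "\<bar>?F x - ?G x\<bar> \<le> 3 * M\<^sup>2 * ((\<bar>s - t\<bar> + \<bar>\<kappa> - \<rho>\<bar> * \<bar>x\<bar>) / t)" .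
    qed
    also have "\<dots> = 3 * M\<^sup>2 * ((\<bar>s - t\<bar> + \<bar>\<kappa> - \<rho>\<bar> * (\<integral>x. \<bar>x\<bar> \<partial>std_normal)) / t)"
      using integral_abs_std_normal_le(1) by (simp add: std_normal.prob_space[simplified])
    also have "\<dots> \<le> 3 * M\<^sup>2 * ((\<bar>s - t\<bar> + \<bar>\<kappa> - \<rho>\<bar>) / t)"
      using integral_abs_std_normal_le(2) t
      by (intro mult_left_mono divide_right_mono add_left_mono mult_left_le) auto
    finally show ?thesis .
  qed
  ultimately show ?thesis by (simp add: distrib_left)
qed

section \<open>Mixtures of Gaussian linear forms\<close>

text \<open>Replaces deviations by variances, which are polynomial or rational in the
  overlaps.\<close>

lemma abs_diff_le_square_diff:
  fixes s t :: real
  assumes "0 \<le> s" "0 < t"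
  shows "\<bar>s - t\<bar> \<le> \<bar>s\<^sup>2 - t\<^sup>2\<bar> / t"
proof -
  have "\<bar>s - t\<bar> * t \<le> \<bar>s - t\<bar> * (s + t)" using assms by (intro mult_left_mono) auto
  also have "\<dots> = \<bar>s\<^sup>2 - t\<^sup>2\<bar>"
    using assms by (simp add: square_diff_square_factored power2_eq_square abs_mult)
  finally show ?thesis using assms by (simp add: le_divide_eq)
qed

text \<open>With \<open>t\<close> the conditional deviation of the limiting pair, the scale error
  costs 1/t twice, once for the smoothing estimate and once for passing to variances. As
  \<open>t \<le> 1\<close>, the factor 1/t^2 dominates the other two errors as well.\<close>

lemma abs_bivariate_diff_le:
  assumes u: "u \<in> borel_measurable borel" and M: "\<And>x. \<bar>u x\<bar> \<le> M"
    and \<alpha>: "0 \<le> \<alpha>" and s: "0 \<le> s" and q: "0 \<le> q" "q < 1"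
  shows "\<bar>smooth \<alpha> (\<lambda>x. u x * smooth s u (\<kappa> * x)) 0 - smooth 1 (\<lambda>x. u x * smooth (sqrt (1 - q\<^sup>2)) u (q * x)) 0\<bar>
    \<le> 3 * M\<^sup>2 / (1 - q\<^sup>2) * (\<bar>\<alpha> - 1\<bar> + \<bar>s\<^sup>2 - (1 - q\<^sup>2)\<bar> + \<bar>\<kappa> - q\<bar>)"
proof -
  define t where "t = sqrt (1 - q\<^sup>2)"
  have "q\<^sup>2 < 1" using q by (simp add: abs_square_less_1)
  then have t: "0 < t" "t \<le> 1" and t2: "t\<^sup>2 = 1 - q\<^sup>2" by (auto simp: t_def)
  have t1: "1 / t\<^sup>2 \<ge> 1" "1 / t \<le> 1 / t\<^sup>2"
    using t by (auto simp: power_le_one power2_eq_square intro!: divide_left_mono mult_left_le mult_le_one)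
  have 1: "\<bar>\<alpha> - 1\<bar> \<le> \<bar>\<alpha> - 1\<bar> * (1 / t\<^sup>2)"
    using mult_left_mono[OF t1(1), of "\<bar>\<alpha> - 1\<bar>"] by simp
  have "\<bar>s - t\<bar> / t \<le> \<bar>s\<^sup>2 - t\<^sup>2\<bar> / t / t"
    using abs_diff_le_square_diff[OF s t(1)] t by (intro divide_right_mono) auto
  then have 2: "\<bar>s - t\<bar> / t \<le> \<bar>s\<^sup>2 - t\<^sup>2\<bar> * (1 / t\<^sup>2)" by (simp add: power2_eq_square)
  have 3: "\<bar>\<kappa> - q\<bar> / t \<le> \<bar>\<kappa> - q\<bar> * (1 / t\<^sup>2)"
    using mult_left_mono[OF t1(2), of "\<bar>\<kappa> - q\<bar>"] by simp
  have "\<bar>\<alpha> - 1\<bar> + (\<bar>s - t\<bar> + \<bar>\<kappa> - q\<bar>) / t \<le> (\<bar>\<alpha> - 1\<bar> + \<bar>s\<^sup>2 - t\<^sup>2\<bar> + \<bar>\<kappa> - q\<bar>) * (1 / t\<^sup>2)"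
    using 1 2 3 unfolding distrib_right add_divide_distrib by linarith
  then have "3 * M\<^sup>2 * (\<bar>\<alpha> - 1\<bar> + (\<bar>s - t\<bar> + \<bar>\<kappa> - q\<bar>) / t)
    \<le> 3 * M\<^sup>2 * ((\<bar>\<alpha> - 1\<bar> + \<bar>s\<^sup>2 - t\<^sup>2\<bar> + \<bar>\<kappa> - q\<bar>) * (1 / t\<^sup>2))"
    by (intro mult_left_mono) auto
  then show ?thesis
    using abs_smooth_mult_smooth_diff_le[OF u M \<alpha> s t(1), of \<kappa> q] unfolding t_def[symmetric]
    by (simp add: t2 mult.commute)
qed

lemma abs_square_diff_le:
  fixes x q :: real
  assumes "\<bar>x\<bar> \<le> 1" "0 \<le> q" "q \<le> 1"
  shows "\<bar>x\<^sup>2 - q\<^sup>2\<bar> \<le> 2 * \<bar>x - q\<bar>"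
proof -
  have "\<bar>x\<^sup>2 - q\<^sup>2\<bar> = \<bar>x + q\<bar> * \<bar>x - q\<bar>"
    by (simp add: power2_eq_square square_diff_square_factored abs_mult)
  also have "\<dots> \<le> 2 * \<bar>x - q\<bar>" using assms by (intro mult_right_mono) auto
  finally show ?thesis .
qed

text \<open>
  \<open>ov\<close> is the overlap, \<open>ov1\<close> and \<open>ov0\<close> its averages over one and over both replicas; they are also
  the covariance of \<open>lin s\<close> with the mean form and the variance of the mean form.
\<close>

locale gaussian_mixture =
  fixes S :: "'s set" and I :: "'i set" and p :: "'s \<Rightarrow> real" and a :: "'s \<Rightarrow> 'i \<Rightarrow> real" and u :: "real \<Rightarrow> real" and M q :: real
  assumes S: "finite S" and I: "finite I"
    and p: "\<And>s. s \<in> S \<Longrightarrow> 0 \<le> p s" "(\<Sum>s\<in>S. p s) = 1"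
    and a: "\<And>s. s \<in> S \<Longrightarrow> (\<Sum>i\<in>I. (a s i)\<^sup>2) = 1"
    and u[measurable]: "u \<in> borel_measurable borel" and M: "\<And>x. \<bar>u x\<bar> \<le> M"
    and q1: "q < 1"
begin

definition lin :: "'s \<Rightarrow> ('i \<Rightarrow> real) \<Rightarrow> real" where "lin s z = (\<Sum>i\<in>I. a s i * z i)"
definition mean :: "'i \<Rightarrow> real" where "mean i = (\<Sum>s\<in>S. a s i * p s)"
definition ov :: "'s \<Rightarrow> 's \<Rightarrow> real" where "ov s t = (\<Sum>i\<in>I. a s i * a t i)"
definition ov1 :: "'s \<Rightarrow> real" where "ov1 s = (\<Sum>i\<in>I. a s i * mean i)"
definition ov0 :: real where "ov0 = (\<Sum>i\<in>I. (mean i)\<^sup>2)"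
definition dev :: real where "dev = (\<Sum>s\<in>S. \<Sum>t\<in>S. \<bar>ov s t - q\<bar> * p s * p t)"
text \<open>For \<open>0 \<le> q\<close> this is the expectation of u(X) u(Y) for a centred Gaussian
  pair with unit variances and covariance \<open>q\<close>, written by conditioning on X.\<close>

definition ref :: real where "ref = smooth 1 (\<lambda>x. u x * smooth (sqrt (1 - q\<^sup>2)) u (q * x)) 0"

lemma M_nonneg: "0 \<le> M" using M[of 0] by linarith

text \<open>Stated for every \<open>z\<close>, so that taking \<open>z\<close> to be
  \<open>a s\<close> or \<open>mean\<close> also yields the formulas for \<open>ov1\<close> and
  \<open>ov0\<close>.\<close>

lemma lin_mean: "(\<Sum>s\<in>S. lin s z * p s) = (\<Sum>i\<in>I. mean i * z i)"
proof -
  have "(\<Sum>s\<in>S. lin s z * p s) = (\<Sum>s\<in>S. \<Sum>i\<in>I. a s i * p s * z i)"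
    by (simp add: lin_def sum_distrib_left sum_distrib_right ac_simps)
  also have "\<dots> = (\<Sum>i\<in>I. \<Sum>s\<in>S. a s i * p s * z i)" by (rule sum.swap)
  finally show ?thesis by (simp add: mean_def sum_distrib_right)
qed

lemma ov1_eq: "ov1 s = (\<Sum>t\<in>S. ov s t * p t)"
  using lin_mean[of "a s"] by (simp add: lin_def ov1_def ov_def mult.commute)

lemma ov0_eq: "ov0 = (\<Sum>s\<in>S. ov1 s * p s)"
  using lin_mean[of mean] by (simp add: lin_def ov1_def ov0_def power2_eq_square)

lemma ov_bound: "\<lbrakk>s \<in> S; t \<in> S\<rbrakk> \<Longrightarrow> \<bar>ov s t\<bar> \<le> 1"
  using Cauchy_Schwarz_ineq_sum[of "a s" "a t" I] a by (simp add: ov_def abs_square_le_1)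

lemma ov1_diff_le: "\<bar>ov1 s - q\<bar> \<le> (\<Sum>t\<in>S. \<bar>ov s t - q\<bar> * p t)"
proof -
  have "ov1 s - q = (\<Sum>t\<in>S. (ov s t - q) * p t)"
    using p(2) by (simp add: ov1_eq left_diff_distrib sum_subtractf flip: sum_distrib_left)
  also have "\<bar>\<dots>\<bar> \<le> (\<Sum>t\<in>S. \<bar>(ov s t - q) * p t\<bar>)" by (rule sum_abs)
  finally show ?thesis using p by (simp add: abs_mult)
qed

lemma sum_ov1_diff_le: "(\<Sum>s\<in>S. \<bar>ov1 s - q\<bar> * p s) \<le> dev"
proof -
  have "(\<Sum>s\<in>S. \<bar>ov1 s - q\<bar> * p s) \<le> (\<Sum>s\<in>S. (\<Sum>t\<in>S. \<bar>ov s t - q\<bar> * p t) * p s)"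
    by (intro sum_mono mult_right_mono ov1_diff_le p)
  then show ?thesis by (simp add: dev_def sum_distrib_left sum_distrib_right ac_simps)
qed

lemma ov0_diff_le: "\<bar>ov0 - q\<bar> \<le> dev"
proof -
  have "ov0 - q = (\<Sum>s\<in>S. (ov1 s - q) * p s)"
    using p(2) by (simp add: ov0_eq left_diff_distrib sum_subtractf flip: sum_distrib_left)
  also have "\<bar>\<dots>\<bar> \<le> (\<Sum>s\<in>S. \<bar>(ov1 s - q) * p s\<bar>)" by (rule sum_abs)
  also have "\<dots> \<le> dev" using p sum_ov1_diff_le by (simp add: abs_mult)
  finally show ?thesis .
qed

lemma ov1_bound: "s \<in> S \<Longrightarrow> \<bar>ov1 s\<bar> \<le> 1"
proof -
  assume s: "s \<in> S"
  have "\<bar>ov1 s\<bar> \<le> (\<Sum>t\<in>S. \<bar>ov s t * p t\<bar>)" unfolding ov1_eq by (rule sum_abs)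
  also have "\<dots> \<le> (\<Sum>t\<in>S. p t)"
    using p ov_bound[OF s] by (intro sum_mono) (simp add: abs_mult mult_left_le_one_le)
  finally show ?thesis using p by simp
qed

lemma ov0_bound: "0 \<le> ov0" "ov0 \<le> 1"
proof -
  show "0 \<le> ov0" unfolding ov0_def by (intro sum_nonneg) auto
  have "ov0 \<le> (\<Sum>t\<in>S. p t)"
    unfolding ov0_eq
  proof (rule sum_mono)
    fix s assume "s \<in> S"
    then show "ov1 s * p s \<le> p s"
      using mult_right_mono[of "ov1 s" 1 "p s"] p(1) ov1_bound by (auto simp: abs_le_iff)
  qed
  then show "ov0 \<le> 1" using p by simp
qed

text \<open>Makes the conditional variance of the mean form given \<open>lin s\<close>, namely
  \<open>ov0\<close> minus the square of \<open>ov1 s\<close>, nonnegative.\<close>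

lemma ov1_square_le: "s \<in> S \<Longrightarrow> (ov1 s)\<^sup>2 \<le> ov0"
  using Cauchy_Schwarz_ineq_sum[of "a s" mean I] a by (simp add: ov1_def ov0_def)

section \<open>The three Gaussian expectations for nonnegative \<open>q\<close>\<close>

context assumes q0: "0 \<le> q" begin

text \<open>The covariance is \<open>ov s t\<close>, so the slope error counts once and the variance
  error, a difference of squares, counts twice.\<close>

lemma two_replica_term:
  assumes "s \<in> S" "t \<in> S"
  shows "\<bar>(\<integral>z. u (lin s z) * u (lin t z) \<partial>gauss I) - ref\<bar> \<le> 3 * M\<^sup>2 / (1 - q\<^sup>2) * (3 * \<bar>ov s t - q\<bar>)"
proof -
  let ?K = "3 * M\<^sup>2 / (1 - q\<^sup>2)"
  have K: "?K \<ge> 0" using q0 q1 by (simp add: abs_square_le_1)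
  have ov: "(ov s t)\<^sup>2 \<le> 1" using ov_bound[OF assms] by (simp add: abs_square_le_1)
  have "(\<integral>z. u (lin s z) * u (lin t z) \<partial>gauss I) = smooth 1 (\<lambda>x. u x * smooth (sqrt (1 - (ov s t)\<^sup>2)) u (ov s t * x)) 0"
    unfolding lin_def using integral_gauss_linear_pair[OF I a[OF assms(1)] u u M M, of "ov s t" "a t"] a[OF assms(2)]
    by (simp add: ov_def)
  then have "\<bar>(\<integral>z. u (lin s z) * u (lin t z) \<partial>gauss I) - ref\<bar>
    \<le> ?K * (\<bar>1 - 1\<bar> + \<bar>(sqrt (1 - (ov s t)\<^sup>2))\<^sup>2 - (1 - q\<^sup>2)\<bar> + \<bar>ov s t - q\<bar>)"
    unfolding ref_def using abs_bivariate_diff_le[OF u M _ _ q0 q1, of 1 "sqrt (1 - (ov s t)\<^sup>2)" "ov s t"] ov by simp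
  also have "\<dots> \<le> ?K * (3 * \<bar>ov s t - q\<bar>)"
    using abs_square_diff_le[OF ov_bound[OF assms] q0] q1 ov
    by (intro mult_left_mono[OF _ K]) simp
  finally show ?thesis .
qed

text \<open>The independent noise of variance 1 - q adds to the conditional variance of the mean
  form given \<open>lin s\<close>. The resulting variance error is the one of \<open>ov0\<close>
  plus a difference of squares in \<open>ov1 s\<close>.\<close>

lemma cross_term:
  assumes "s \<in> S"
  shows "\<bar>(\<integral>z. u (lin s z) * smooth (sqrt (1 - q)) u (\<Sum>i\<in>I. mean i * z i) \<partial>gauss I) - ref\<bar>
    \<le> 3 * M\<^sup>2 / (1 - q\<^sup>2) * (\<bar>ov0 - q\<bar> + 3 * \<bar>ov1 s - q\<bar>)"
proof -
  let ?K = "3 * M\<^sup>2 / (1 - q\<^sup>2)"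
  have K: "?K \<ge> 0" using q0 q1 by (simp add: abs_square_le_1)
  have ov: "(ov1 s)\<^sup>2 \<le> ov0" by (rule ov1_square_le[OF assms])
  define \<sigma> where "\<sigma> = sqrt ((1 - q) + (ov0 - (ov1 s)\<^sup>2))"
  have \<sigma>: "0 \<le> \<sigma>" "\<sigma>\<^sup>2 = (1 - q) + (ov0 - (ov1 s)\<^sup>2)" using ov q1 by (auto simp: \<sigma>_def)
  have "smooth (sqrt (ov0 - (ov1 s)\<^sup>2)) (smooth (sqrt (1 - q)) u) = smooth \<sigma> u"
    using smooth_smooth[OF u M, of "sqrt (ov0 - (ov1 s)\<^sup>2)" "sqrt (1 - q)"] ov q1 by (auto simp: \<sigma>_def fun_eq_iff)
  then have "(\<integral>z. u (lin s z) * smooth (sqrt (1 - q)) u (\<Sum>i\<in>I. mean i * z i) \<partial>gauss I)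
    = smooth 1 (\<lambda>x. u x * smooth \<sigma> u (ov1 s * x)) 0"
    unfolding lin_def using integral_gauss_linear_pair[OF I a[OF assms(1)] u borel_measurable_smooth[OF u] M abs_smooth_le[OF M], of "ov1 s" mean]
    by (simp add: ov1_def ov0_def)
  then have "\<bar>(\<integral>z. u (lin s z) * smooth (sqrt (1 - q)) u (\<Sum>i\<in>I. mean i * z i) \<partial>gauss I) - ref\<bar>
    \<le> ?K * (\<bar>1 - 1\<bar> + \<bar>\<sigma>\<^sup>2 - (1 - q\<^sup>2)\<bar> + \<bar>ov1 s - q\<bar>)"
    unfolding ref_def using abs_bivariate_diff_le[OF u M _ \<sigma>(1) q0 q1, of 1 "ov1 s"] by simp
  also have "\<dots> \<le> ?K * (\<bar>ov0 - q\<bar> + 3 * \<bar>ov1 s - q\<bar>)"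
    using abs_square_diff_le[OF ov1_bound[OF assms] q0 less_imp_le[OF q1]] \<sigma>(2)
    by (intro mult_left_mono[OF _ K]) simp
  finally show ?thesis .
qed

text \<open>Given the mean form, the two noisy copies are independent, hence the square.
  Conditioning instead on the first copy, of variance \<open>\<alpha>\<close> squared, brings the
  expectation to the shape of \<open>ref\<close>, with slope \<open>\<kappa>\<close> and conditional
  variance \<open>\<sigma>\<close> squared. The 5 collects 1 from \<open>\<alpha>\<close>, 3 from
  \<open>\<sigma>\<close> and 1 from \<open>\<kappa>\<close>.\<close>

lemma smoothed_term:
  "\<bar>(\<integral>z. (smooth (sqrt (1 - q)) u (\<Sum>i\<in>I. mean i * z i))\<^sup>2 \<partial>gauss I) - ref\<bar> \<le> 3 * M\<^sup>2 / (1 - q\<^sup>2) * (5 * \<bar>ov0 - q\<bar>)"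
proof -
  let ?K = "3 * M\<^sup>2 / (1 - q\<^sup>2)"
  have K: "?K \<ge> 0" using q0 q1 by (simp add: abs_square_le_1)
  define \<tau> where "\<tau> = sqrt (1 - q)"
  have \<tau>: "0 < \<tau>" "\<tau>\<^sup>2 = 1 - q" using q1 by (auto simp: \<tau>_def)
  define \<alpha> where "\<alpha> = sqrt ((sqrt ov0)\<^sup>2 + \<tau>\<^sup>2)"
  have \<alpha>2: "\<alpha>\<^sup>2 = ov0 + (1 - q)" using ov0_bound(1) \<tau> q1 by (simp add: \<alpha>_def)
  have \<alpha>: "0 < \<alpha>" using ov0_bound(1) \<tau> q1 by (simp add: \<alpha>_def)
  define \<kappa> where "\<kappa> = ov0 / \<alpha>\<^sup>2"
  have \<kappa>\<alpha>: "\<kappa> * \<alpha>\<^sup>2 = ov0" using \<alpha> by (simp add: \<kappa>_def)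
  \<comment> \<open>The slope error is the error of \<open>ov0\<close> times a factor at most 1,
    because \<alpha>^2 \<ge> 1 - q.\<close>
  have \<kappa>: "\<bar>\<kappa> - q\<bar> \<le> \<bar>ov0 - q\<bar>"
  proof -
    have "\<kappa> - q = (ov0 - q) * ((1 - q) / \<alpha>\<^sup>2)"
    proof -
      have "ov0 - q * \<alpha>\<^sup>2 = (ov0 - q) * (1 - q)" unfolding \<alpha>2 by (simp add: algebra_simps)
      moreover have "\<kappa> - q = (ov0 - q * \<alpha>\<^sup>2) / \<alpha>\<^sup>2" using \<alpha> by (simp add: \<kappa>_def diff_divide_distrib)
      ultimately show ?thesis by simp
    qed
    moreover have "\<bar>(1 - q) / \<alpha>\<^sup>2\<bar> \<le> 1"
      using \<alpha>2 \<alpha> ov0_bound(1) q1 by (simp add: divide_le_eq)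
    ultimately show ?thesis using mult_left_mono[of "\<bar>(1 - q) / \<alpha>\<^sup>2\<bar>" 1 "\<bar>ov0 - q\<bar>"] by (simp add: abs_mult)
  qed
  define \<sigma> where "\<sigma> = sqrt (\<tau>\<^sup>2 + (sqrt ov0 * \<tau> / \<alpha>)\<^sup>2)"
  have \<sigma>: "0 \<le> \<sigma>" by (simp add: \<sigma>_def)
  have "\<sigma>\<^sup>2 = (1 - q) + \<kappa> * (1 - q)"
    using ov0_bound(1) \<tau>(2) q1 by (simp add: \<sigma>_def \<kappa>_def power_mult_distrib power_divide)
  also have "\<dots> = \<alpha>\<^sup>2 - \<kappa> * ov0" using \<kappa>\<alpha> unfolding \<alpha>2 by (simp add: algebra_simps)
  \<comment> \<open>The variance error splits into three terms, each at most \<bar>ov0 -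
    q\<bar>.\<close>
  finally have \<sigma>2: "\<sigma>\<^sup>2 - (1 - q\<^sup>2) = (ov0 - q) - (\<kappa> - q) * ov0 - q * (ov0 - q)"
    unfolding \<alpha>2 by (simp add: power2_eq_square algebra_simps)
  have "\<bar>(\<kappa> - q) * ov0\<bar> \<le> \<bar>ov0 - q\<bar>"
    using \<kappa> ov0_bound by (simp add: abs_mult) (meson abs_ge_zero mult_left_le order_trans)
  moreover have "\<bar>q * (ov0 - q)\<bar> \<le> \<bar>ov0 - q\<bar>" using q0 q1 by (simp add: abs_mult mult_left_le_one_le)
  ultimately have \<sigma>3: "\<bar>\<sigma>\<^sup>2 - (1 - q\<^sup>2)\<bar> \<le> 3 * \<bar>ov0 - q\<bar>" unfolding \<sigma>2
  proof -
    show "\<lbrakk>\<bar>y\<bar> \<le> \<bar>x\<bar>; \<bar>z\<bar> \<le> \<bar>x\<bar>\<rbrakk> \<Longrightarrow> \<bar>x - y - z\<bar> \<le> 3 * \<bar>x\<bar>" for x y z :: real by linarith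
  qed
  have \<alpha>3: "\<bar>\<alpha> - 1\<bar> \<le> \<bar>ov0 - q\<bar>"
    using abs_diff_le_square_diff[of \<alpha> 1] \<alpha> \<alpha>2 by simp
  let ?v = "smooth \<tau> u"
  have "(\<integral>z. (?v (\<Sum>i\<in>I. mean i * z i))\<^sup>2 \<partial>gauss I) = (\<integral>y. (?v y)\<^sup>2 \<partial>distr (gauss I) borel (\<lambda>z. \<Sum>i\<in>I. mean i * z i))"
    by (subst integral_distr) auto
  also have "\<dots> = smooth (sqrt ov0) (\<lambda>x. ?v x * ?v x) 0"
    unfolding distr_gauss_linear[OF I] ov0_def[symmetric]
    by (subst integral_distr) (auto simp: smooth_def[of "sqrt ov0"] power2_eq_square)
  also have "\<dots> = smooth \<alpha> (\<lambda>x. u x * smooth (sqrt ov0 * \<tau> / \<alpha>) ?v (\<kappa> * x)) 0"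
    using smooth_mult_smooth[OF u borel_measurable_smooth[OF u] M abs_smooth_le[OF M] \<tau>(1) \<alpha>_def] ov0_bound(1) by (simp add: \<kappa>_def)
  also have "\<dots> = smooth \<alpha> (\<lambda>x. u x * smooth \<sigma> u (\<kappa> * x)) 0"
    using smooth_smooth[OF u M, of "sqrt ov0 * \<tau> / \<alpha>" \<tau>] ov0_bound(1) \<tau> \<alpha> by (simp add: \<sigma>_def)
  finally have "\<bar>(\<integral>z. (?v (\<Sum>i\<in>I. mean i * z i))\<^sup>2 \<partial>gauss I) - ref\<bar>
    \<le> ?K * (\<bar>\<alpha> - 1\<bar> + \<bar>\<sigma>\<^sup>2 - (1 - q\<^sup>2)\<bar> + \<bar>\<kappa> - q\<bar>)"
    unfolding ref_def using abs_bivariate_diff_le[OF u M _ \<sigma> q0 q1, of \<alpha> \<kappa>] \<alpha> by simp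
  also have "\<dots> \<le> ?K * (5 * \<bar>ov0 - q\<bar>)"
    using \<alpha>3 \<sigma>3 \<kappa> by (intro mult_left_mono[OF _ K]) linarith
  finally show ?thesis by (simp add: \<tau>_def)
qed

lemma mixture_error_le_nonneg:
  "(\<integral>z. ((\<Sum>s\<in>S. u (lin s z) * p s) - smooth (sqrt (1 - q)) u (\<Sum>s\<in>S. lin s z * p s))\<^sup>2 \<partial>gauss I)
    \<le> 48 / (1 - q\<^sup>2) * M\<^sup>2 * dev"
proof -
  let ?K = "3 * M\<^sup>2 / (1 - q\<^sup>2)"
  have K: "?K \<ge> 0" using q0 q1 by (simp add: abs_square_le_1)
  let ?v = "\<lambda>z. smooth (sqrt (1 - q)) u (\<Sum>i\<in>I. mean i * z i)"
  have [measurable]: "lin s \<in> borel_measurable (gauss I)" for s unfolding lin_def by measurable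
  have int: "integrable (gauss I) (\<lambda>z. u (lin s z) * u (lin t z))" "integrable (gauss I) (\<lambda>z. u (lin s z) * ?v z)"
    "integrable (gauss I) (\<lambda>z. (?v z)\<^sup>2)" for s t
    unfolding power2_eq_square
    by (rule integrable_bounded_mult_prob_space[OF prob_space_gauss, where B = M]; auto intro!: M abs_smooth_le)+
  let ?E1 = "\<lambda>s t. \<integral>z. u (lin s z) * u (lin t z) \<partial>gauss I" and ?E2 = "\<lambda>s. \<integral>z. u (lin s z) * ?v z \<partial>gauss I"
    and ?E3 = "\<integral>z. (?v z)\<^sup>2 \<partial>gauss I"
  have "((\<Sum>s\<in>S. u (lin s z) * p s) - ?v z)\<^sup>2
    = (\<Sum>s\<in>S. \<Sum>t\<in>S. u (lin s z) * u (lin t z) * (p s * p t)) - 2 * (\<Sum>s\<in>S. u (lin s z) * ?v z * p s) + (?v z)\<^sup>2" for z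
    unfolding power2_diff power2_eq_square[of "sum _ _"] sum_product
    by (simp add: sum_distrib_left sum_distrib_right ac_simps)
  then have "(\<integral>z. ((\<Sum>s\<in>S. u (lin s z) * p s) - ?v z)\<^sup>2 \<partial>gauss I)
    = (\<Sum>s\<in>S. \<Sum>t\<in>S. ?E1 s t * (p s * p t)) - 2 * (\<Sum>s\<in>S. ?E2 s * p s) + ?E3"
    using int by simp
  \<comment> \<open>Since the weights sum to 1, \<open>ref\<close> enters with total coefficient 1 -
    2 + 1 = 0.\<close>
  also have "\<dots> = (\<Sum>s\<in>S. \<Sum>t\<in>S. (?E1 s t - ref) * (p s * p t)) - 2 * (\<Sum>s\<in>S. (?E2 s - ref) * p s) + (?E3 - ref)"
  proof -
    have "(\<Sum>s\<in>S. \<Sum>t\<in>S. ref * (p s * p t)) = ref"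
      using p(2) by (simp flip: sum_distrib_left sum_distrib_right)
    moreover have "(\<Sum>s\<in>S. ref * p s) = ref" using p(2) by (simp flip: sum_distrib_left)
    ultimately show ?thesis by (simp add: left_diff_distrib sum_subtractf)
  qed
  also have "\<dots> \<le> (\<Sum>s\<in>S. \<Sum>t\<in>S. ?K * (3 * \<bar>ov s t - q\<bar>) * (p s * p t))
      + 2 * (\<Sum>s\<in>S. ?K * (\<bar>ov0 - q\<bar> + 3 * \<bar>ov1 s - q\<bar>) * p s) + ?K * (5 * \<bar>ov0 - q\<bar>)"
  proof -
    have "(\<Sum>s\<in>S. \<Sum>t\<in>S. (?E1 s t - ref) * (p s * p t)) \<le> (\<Sum>s\<in>S. \<Sum>t\<in>S. ?K * (3 * \<bar>ov s t - q\<bar>) * (p s * p t))"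
      using p(1) two_replica_term by (intro sum_mono mult_right_mono) (auto simp: abs_le_iff)
    moreover have "- (\<Sum>s\<in>S. (?E2 s - ref) * p s) \<le> (\<Sum>s\<in>S. ?K * (\<bar>ov0 - q\<bar> + 3 * \<bar>ov1 s - q\<bar>) * p s)"
      unfolding sum_negf[symmetric] mult_minus_left[symmetric]
      using p(1) cross_term by (intro sum_mono mult_right_mono) (auto simp: abs_le_iff)
    ultimately show ?thesis using smoothed_term by linarith
  qed
  also have "\<dots> = ?K * (3 * dev + 2 * (\<bar>ov0 - q\<bar> + 3 * (\<Sum>s\<in>S. \<bar>ov1 s - q\<bar> * p s)) + 5 * \<bar>ov0 - q\<bar>)"
  proof -
    have "(\<Sum>s\<in>S. \<Sum>t\<in>S. ?K * (3 * \<bar>ov s t - q\<bar>) * (p s * p t)) = ?K * (3 * dev)"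
      by (simp add: dev_def sum_distrib_left ac_simps)
    moreover have "(\<Sum>s\<in>S. ?K * (\<bar>ov0 - q\<bar> + 3 * \<bar>ov1 s - q\<bar>) * p s)
      = ?K * (\<bar>ov0 - q\<bar> * (\<Sum>s\<in>S. p s) + 3 * (\<Sum>s\<in>S. \<bar>ov1 s - q\<bar> * p s))"
      unfolding sum_distrib_left sum.distrib[symmetric] by (simp add: algebra_simps)
    ultimately show ?thesis using p(2) by (simp only: distrib_left)
  qed
  \<comment> \<open>All averaged errors are at most \<open>dev\<close>, and 3 (3 + 8 + 5) =
    48.\<close>
  also have "\<dots> \<le> ?K * (3 * dev + 2 * (dev + 3 * dev) + 5 * dev)"
    by (intro mult_left_mono[OF _ K] add_mono mult_left_mono order_refl sum_ov1_diff_le ov0_diff_le) auto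
  also have "\<dots> = 48 / (1 - q\<^sup>2) * M\<^sup>2 * dev" by simp
  finally show ?thesis unfolding lin_mean .
qed

end

lemma mixture_error_le:
  "(\<integral>z. ((\<Sum>s\<in>S. u (lin s z) * p s) - smooth (sqrt (1 - q)) u (\<Sum>s\<in>S. lin s z * p s))\<^sup>2 \<partial>gauss I)
    \<le> (if q < 0 then 4 / (- q) else 48 / (1 - q\<^sup>2)) * M\<^sup>2 * dev"
proof (cases "q < 0")
  case True
  let ?f = "\<lambda>z. ((\<Sum>s\<in>S. u (lin s z) * p s) - smooth (sqrt (1 - q)) u (\<Sum>s\<in>S. lin s z * p s))\<^sup>2"
  have "\<bar>?f z\<bar> \<le> 4 * M\<^sup>2" for z
  proof -
    have "\<bar>\<Sum>s\<in>S. u (lin s z) * p s\<bar> \<le> (\<Sum>s\<in>S. \<bar>u (lin s z) * p s\<bar>)" by (rule sum_abs)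
    also have "\<dots> \<le> (\<Sum>s\<in>S. M * p s)" using p(1) M by (intro sum_mono) (simp add: abs_mult mult_right_mono)
    also have "\<dots> = M" using p(2) by (simp flip: sum_distrib_left)
    finally have "\<bar>(\<Sum>s\<in>S. u (lin s z) * p s) - smooth (sqrt (1 - q)) u (\<Sum>s\<in>S. lin s z * p s)\<bar> \<le> 2 * M"
      using abs_smooth_le[of u M "sqrt (1 - q)" "\<Sum>s\<in>S. lin s z * p s"] M by fastforce
    then have "?f z \<le> (2 * M)\<^sup>2" using abs_le_square_iff M_nonneg by fastforce
    then show ?thesis by (simp add: power_mult_distrib)
  qed
  then have "(\<integral>z. ?f z \<partial>gauss I) \<le> 4 * M\<^sup>2"
    using abs_integral_le_prob_space[OF prob_space_gauss, of ?f "4 * M\<^sup>2"] by (simp add: abs_le_iff)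
  also have "\<dots> = 4 / (- q) * M\<^sup>2 * (- q)" using True by simp
  \<comment> \<open>As \<open>ov0\<close> is nonnegative, its distance to a negative
    \<open>q\<close> is at least -q, and \<open>dev\<close> dominates this distance.\<close>
  also have "\<dots> \<le> 4 / (- q) * M\<^sup>2 * dev"
    using ov0_diff_le ov0_bound(1) True by (intro mult_left_mono) (auto simp: divide_simps)
  finally show ?thesis using True by simp
next
  case False
  then show ?thesis using mixture_error_le_nonneg by simp
qed

end

section \<open>The cavity field\<close>

text \<open>Fixing the value 0 beyond \<open>N\<close> leaves finitely many functions.\<close>

lemma finite_spins: "finite (spins N)"
proof -
  have "spins N = {f. \<forall>i. (i \<in> {..<N} \<longrightarrow> f i \<in> {1, -1}) \<and> (i \<notin> {..<N} \<longrightarrow> f i = 0)}"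
    unfolding spins_def by (intro Collect_cong) (simp add: all_conj_distrib not_less)
  then show ?thesis by (simp only: finite_set_of_finite_funs finite_lessThan finite.intros)
qed

lemma gibbs_prob: "0 \<le> gibbs \<beta> h N g \<sigma>" "(\<Sum>\<sigma>\<in>spins N. gibbs \<beta> h N g \<sigma>) = 1"
proof -
  have "(\<lambda>i. if i < N then 1 else 0) \<in> spins N" by (simp add: spins_def)
  then have "SK_Z \<beta> h N g > 0"
    unfolding SK_Z_def by (intro sum_pos finite_spins) auto
  then show "0 \<le> gibbs \<beta> h N g \<sigma>" "(\<Sum>\<sigma>\<in>spins N. gibbs \<beta> h N g \<sigma>) = 1"
    by (auto simp: gibbs_def SK_Z_def simp flip: sum_divide_distrib)
qed

lemma borel_measurable_gibbs[measurable]: "(\<lambda>g. gibbs \<beta> h N g \<sigma>) \<in> borel_measurable (gauss (pairs N))"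
proof -
  have "(\<lambda>g. SK_H \<beta> h N g \<tau>) \<in> borel_measurable (gauss (pairs N))" for \<tau>
    unfolding SK_H_def case_prod_beta'
    by (intro borel_measurable_add borel_measurable_times borel_measurable_sum borel_measurable_const
        measurable_gauss_component) auto
  note [measurable] = this
  show ?thesis unfolding gibbs_def SK_Z_def by measurable
qed

lemma borel_measurable_cavity[measurable]: "(\<lambda>z. cavity N z \<sigma>) \<in> borel_measurable (gauss {..<N})"
  unfolding cavity_def
  by (intro borel_measurable_divide borel_measurable_times borel_measurable_sum borel_measurable_const
        measurable_gauss_component) auto

text \<open>For frozen disorder the cavity field is a mixture with Gibbs weights and coefficient
  vectors \<sigma>/sqrt(N), of unit norm because spins square to 1. Then \<open>lin\<close>,
  \<open>ov\<close> and \<open>dev\<close> are the cavity field, the overlap and its mean absolute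
  deviation from \<open>q\<close>.\<close>

lemma cavity_error_le:
  assumes N: "N \<ge> 1" and u: "u \<in> borel_measurable borel" and M: "\<And>t. \<bar>u t\<bar> \<le> M" and q: "q < 1"
  shows "(\<integral>z. (gavg1 \<beta> h N g (\<lambda>\<sigma>. u (cavity N z \<sigma>)) - smooth (sqrt (1 - q)) u (gavg1 \<beta> h N g (cavity N z)))\<^sup>2 \<partial>gauss {..<N})
    \<le> (if q < 0 then 4 / (- q) else 48 / (1 - q\<^sup>2)) * M\<^sup>2 * gavg2 \<beta> h N g (\<lambda>\<sigma>1 \<sigma>2. \<bar>overlap N \<sigma>1 \<sigma>2 - q\<bar>)"
proof -
  interpret gaussian_mixture "spins N" "{..<N}" "gibbs \<beta> h N g" "\<lambda>\<sigma> i. \<sigma> i / sqrt (real N)" u M q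
  proof
    fix \<sigma> assume "\<sigma> \<in> spins N"
    then have "(\<sigma> i)\<^sup>2 = 1" if "i < N" for i using that by (auto simp: spins_def power2_eq_1_iff)
    then show "(\<Sum>i<N. (\<sigma> i / sqrt (real N))\<^sup>2) = 1" using N by (simp add: power_divide)
  qed (use assms gibbs_prob finite_spins in auto)
  have "lin \<sigma> z = cavity N z \<sigma>" for \<sigma> z
    by (simp add: lin_def cavity_def sum_divide_distrib mult.commute)
  moreover have "dev = gavg2 \<beta> h N g (\<lambda>\<sigma>1 \<sigma>2. \<bar>overlap N \<sigma>1 \<sigma>2 - q\<bar>)"
    using N by (simp add: dev_def gavg2_def ov_def overlap_def sum_divide_distrib)
  ultimately show ?thesis
    using mixture_error_le by (simp add: gavg1_def)
qed

text \<open>This is y \<le> 1 + y^4 at y = \<bar>x\<bar> sqrt(n), the scaling at which a fourth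
  moment of order 1/n^2 becomes bounded. It is a pointwise substitute for Jensen's
  inequality.\<close>

lemma abs_le_fourth_power: "\<bar>x\<bar> \<le> (1 + n\<^sup>2 * x ^ 4) / sqrt n" if "0 < n" for x n :: real
proof -
  let ?y = "\<bar>x\<bar> * sqrt n"
  have "?y \<le> 1 + ?y ^ 4"
  proof (cases "?y \<le> 1")
    case True
    then show ?thesis by (simp add: add_increasing2)
  next
    case False
    then have "?y ^ 1 \<le> ?y ^ 4" by (intro power_increasing) auto
    then show ?thesis by simp
  qed
  also have "?y ^ 4 = (?y\<^sup>2)\<^sup>2" by simp
  also have "\<dots> = n\<^sup>2 * x ^ 4"
    using that by (simp add: power_mult_distrib)
  finally show ?thesis using that by (simp add: le_divide_eq)
qed

text \<open>A finite sum whose \<open>f\<close>-values are constant in the disorder, with Gibbs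
  weights between 0 and 1.\<close>

lemma integrable_gavg2: "integrable (gauss (pairs N)) (\<lambda>g. gavg2 \<beta> h N g f)"
proof -
  have "\<bar>gibbs \<beta> h N g \<sigma>\<bar> \<le> 1" if "\<sigma> \<in> spins N" for g \<sigma>
    using member_le_sum[of \<sigma> "spins N" "gibbs \<beta> h N g"] that gibbs_prob finite_spins by simp
  then have "integrable (gauss (pairs N)) (\<lambda>g. gibbs \<beta> h N g \<sigma> * gibbs \<beta> h N g \<tau>)"
    if "\<sigma> \<in> spins N" "\<tau> \<in> spins N" for \<sigma> \<tau>
    using that by (intro integrable_bounded_mult_prob_space[OF prob_space_gauss, where B = 1]) auto
  then show ?thesis
    unfolding gavg2_def mult.assoc by (intro Bochner_Integration.integrable_sum) simp
qed

lemma gavg2_abs_le: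
  assumes N: "N \<ge> 1"
  shows "gavg2 \<beta> h N g (\<lambda>\<sigma>1 \<sigma>2. \<bar>f \<sigma>1 \<sigma>2\<bar>) \<le> (1 + (real N)\<^sup>2 * gavg2 \<beta> h N g (\<lambda>\<sigma>1 \<sigma>2. f \<sigma>1 \<sigma>2 ^ 4)) / sqrt (real N)"
proof -
  let ?p = "gibbs \<beta> h N g"
  have "gavg2 \<beta> h N g (\<lambda>\<sigma>1 \<sigma>2. \<bar>f \<sigma>1 \<sigma>2\<bar>) \<le> gavg2 \<beta> h N g (\<lambda>\<sigma>1 \<sigma>2. (1 + (real N)\<^sup>2 * f \<sigma>1 \<sigma>2 ^ 4) / sqrt (real N))"
    unfolding gavg2_def using N by (intro sum_mono mult_right_mono gibbs_prob abs_le_fourth_power) auto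
  also have "\<dots> = ((\<Sum>\<sigma>\<in>spins N. \<Sum>\<tau>\<in>spins N. ?p \<sigma> * ?p \<tau>) + (real N)\<^sup>2 * gavg2 \<beta> h N g (\<lambda>\<sigma>1 \<sigma>2. f \<sigma>1 \<sigma>2 ^ 4)) / sqrt (real N)"
    by (simp add: gavg2_def sum_distrib_left sum_divide_distrib add_divide_distrib distrib_left sum.distrib ac_simps)
  also have "(\<Sum>\<sigma>\<in>spins N. \<Sum>\<tau>\<in>spins N. ?p \<sigma> * ?p \<tau>) = 1"
    using gibbs_prob(2) by (simp flip: sum_product)
  finally show ?thesis .
qed

theorem theorem1p5:
  fixes \<beta> h q C0 :: real
  assumes "\<beta> > 0" and "q < 1"
    and hyp: "\<forall>N::nat. N \<ge> 1 \<longrightarrow>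
      (\<integral>g. gavg2 \<beta> h N g (\<lambda>\<sigma>1 \<sigma>2. (overlap N \<sigma>1 \<sigma>2 - q) ^ 4) \<partial>gauss (pairs N))
        \<le> C0 / (real N)\<^sup>2"
  shows "\<exists>C::real. \<forall>N::nat. \<forall>u::real \<Rightarrow> real.
      N \<ge> 1 \<longrightarrow> u \<in> borel_measurable borel \<longrightarrow> bounded (range u) \<longrightarrow>
      (\<integral>gz. (gavg1 \<beta> h N (fst gz) (\<lambda>\<sigma>. u (cavity N (snd gz) \<sigma>))
               - (\<integral>t. u t * normal_density (gavg1 \<beta> h N (fst gz) (cavity N (snd gz))) (sqrt (1 - q)) t \<partial>lborel))\<^sup>2
         \<partial>(gauss (pairs N) \<Otimes>\<^sub>M gauss {..<N}))
      \<le> C * (SUP t. \<bar>u t\<bar>)\<^sup>2 / sqrt (real N)"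
proof -
  define K where "K = (if q < 0 then 4 / (- q) else 48 / (1 - q\<^sup>2))"
  have K: "0 \<le> K" using \<open>q < 1\<close> by (simp add: K_def abs_square_le_1 divide_nonneg_neg)
  show ?thesis
  \<comment> \<open>\<open>K\<close> depends on \<open>q\<close> alone; 1 + C0 is what the
    fourth-power bound gives after averaging over the disorder.\<close>
  proof (intro exI[of _ "K * (1 + C0)"] allI impI)
    fix N :: nat and u :: "real \<Rightarrow> real"
    assume N: "N \<ge> 1" and u[measurable]: "u \<in> borel_measurable borel" and bdd: "bounded (range u)"
    define M where "M = (SUP t. \<bar>u t\<bar>)"
    from bdd obtain B where "\<bar>u t\<bar> \<le> B" for t by (auto simp: bounded_iff)
    \<comment> \<open>A real supremum bounds its elements only when the set is bounded
      above.\<close>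
    then have "bdd_above (range (\<lambda>t. \<bar>u t\<bar>))" by (rule bdd_aboveI2)
    then have M: "\<bar>u t\<bar> \<le> M" for t unfolding M_def by (intro cSUP_upper) auto
    let ?T = "smooth (sqrt (1 - q)) u"
    define F where "F g z = (gavg1 \<beta> h N g (\<lambda>\<sigma>. u (cavity N z \<sigma>)) - ?T (gavg1 \<beta> h N g (cavity N z)))\<^sup>2" for g z
    interpret A: prob_space "gauss (pairs N)" by (rule prob_space_gauss)
    interpret B: prob_space "gauss {..<N}" by (rule prob_space_gauss)
    interpret AB: pair_prob_space "gauss (pairs N)" "gauss {..<N}" ..
    have F_le: "\<bar>F g z\<bar> \<le> (2 * M)\<^sup>2" for g z
    proof -
      have "\<bar>gavg1 \<beta> h N g (\<lambda>\<sigma>. u (cavity N z \<sigma>))\<bar> \<le> (\<Sum>\<sigma>\<in>spins N. \<bar>u (cavity N z \<sigma>) * gibbs \<beta> h N g \<sigma>\<bar>)"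
        unfolding gavg1_def by (rule sum_abs)
      also have "\<dots> \<le> (\<Sum>\<sigma>\<in>spins N. M * gibbs \<beta> h N g \<sigma>)"
        using gibbs_prob(1) M by (intro sum_mono) (simp add: abs_mult mult_right_mono)
      also have "\<dots> = M" using gibbs_prob(2) by (simp flip: sum_distrib_left)
      finally have "\<bar>gavg1 \<beta> h N g (\<lambda>\<sigma>. u (cavity N z \<sigma>)) - ?T (gavg1 \<beta> h N g (cavity N z))\<bar> \<le> \<bar>2 * M\<bar>"
        using abs_smooth_le[of u M "sqrt (1 - q)" "gavg1 \<beta> h N g (cavity N z)"] M by fastforce
      then show ?thesis unfolding F_def by (simp add: abs_le_square_iff)
    qed
    have meas: "(\<lambda>gz. F (fst gz) (snd gz)) \<in> borel_measurable (gauss (pairs N) \<Otimes>\<^sub>M gauss {..<N})"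
      unfolding F_def gavg1_def by measurable
    have int: "integrable (gauss (pairs N) \<Otimes>\<^sub>M gauss {..<N}) (\<lambda>gz. F (fst gz) (snd gz))"
      by (rule integrable_bounded_prob_space[OF AB.prob_space_axioms meas F_le])
    \<comment> \<open>Fubini lets the cavity variables be integrated first, with the disorder frozen
      as \<open>cavity_error_le\<close> requires.\<close>
    have "(\<integral>gz. F (fst gz) (snd gz) \<partial>(gauss (pairs N) \<Otimes>\<^sub>M gauss {..<N})) = (\<integral>g. \<integral>z. F g z \<partial>gauss {..<N} \<partial>gauss (pairs N))"
      using AB.integral_fst'[OF int] by simp
    also have "\<dots> \<le> (\<integral>g. K * M\<^sup>2 * ((1 + (real N)\<^sup>2 * gavg2 \<beta> h N g (\<lambda>\<sigma>1 \<sigma>2. (overlap N \<sigma>1 \<sigma>2 - q) ^ 4)) / sqrt (real N)) \<partial>gauss (pairs N))"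
    proof (rule integral_mono)
      show "integrable (gauss (pairs N)) (\<lambda>g. \<integral>z. F g z \<partial>gauss {..<N})"
        using AB.integrable_fst'[OF int] by simp
      fix g
      have "(\<integral>z. F g z \<partial>gauss {..<N}) \<le> K * M\<^sup>2 * gavg2 \<beta> h N g (\<lambda>\<sigma>1 \<sigma>2. \<bar>overlap N \<sigma>1 \<sigma>2 - q\<bar>)"
        unfolding F_def K_def by (rule cavity_error_le[OF N u M \<open>q < 1\<close>])
      also have "\<dots> \<le> K * M\<^sup>2 * ((1 + (real N)\<^sup>2 * gavg2 \<beta> h N g (\<lambda>\<sigma>1 \<sigma>2. (overlap N \<sigma>1 \<sigma>2 - q) ^ 4)) / sqrt (real N))"
        using K by (intro mult_left_mono gavg2_abs_le N) auto
      finally show "(\<integral>z. F g z \<partial>gauss {..<N})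
        \<le> K * M\<^sup>2 * ((1 + (real N)\<^sup>2 * gavg2 \<beta> h N g (\<lambda>\<sigma>1 \<sigma>2. (overlap N \<sigma>1 \<sigma>2 - q) ^ 4)) / sqrt (real N))" .
    qed (simp add: integrable_gavg2)
    also have "\<dots> = K * M\<^sup>2 * ((1 + (real N)\<^sup>2 * (\<integral>g. gavg2 \<beta> h N g (\<lambda>\<sigma>1 \<sigma>2. (overlap N \<sigma>1 \<sigma>2 - q) ^ 4) \<partial>gauss (pairs N))) / sqrt (real N))"
      by (simp add: integrable_gavg2 A.prob_space)
    also have "\<dots> \<le> K * M\<^sup>2 * ((1 + (real N)\<^sup>2 * (C0 / (real N)\<^sup>2)) / sqrt (real N))"
      using K hyp N by (intro mult_left_mono divide_right_mono add_left_mono) auto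
    also have "\<dots> = K * (1 + C0) * M\<^sup>2 / sqrt (real N)"
      using N by simp
    finally have "(\<integral>gz. F (fst gz) (snd gz) \<partial>(gauss (pairs N) \<Otimes>\<^sub>M gauss {..<N})) \<le> K * (1 + C0) * M\<^sup>2 / sqrt (real N)" .
    moreover have "(\<integral>t. u t * normal_density x (sqrt (1 - q)) t \<partial>lborel) = ?T x" for x
      using smooth_eq_integral_normal_density[OF u, of "sqrt (1 - q)" x] \<open>q < 1\<close> by simp
    ultimately show "(\<integral>gz. (gavg1 \<beta> h N (fst gz) (\<lambda>\<sigma>. u (cavity N (snd gz) \<sigma>))
               - (\<integral>t. u t * normal_density (gavg1 \<beta> h N (fst gz) (cavity N (snd gz))) (sqrt (1 - q)) t \<partial>lborel))\<^sup>2
         \<partial>(gauss (pairs N) \<Otimes>\<^sub>M gauss {..<N}))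
      \<le> K * (1 + C0) * (SUP t. \<bar>u t\<bar>)\<^sup>2 / sqrt (real N)"
      unfolding F_def M_def by (simp only:)
  qed
qed

end
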